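(* Let $G$ be a group. All $G$-trees are simplicial trees with an action of $G$ without inversions. (1) In each deformation space of $G$-trees there is, up to $G$-equivariant isomorphism, at most one strongly slide-free minimal $G$-tree. (2) More precisely, let $T,T'$ be two minimal simplicial $G$-trees which have the same elliptic subgroups (i.e. a subgroup $H<G$ is elliptic in $T$ if and only if it is elliptic in $T'$). Assume that $T$ is strongly slide-free and that $T'$ is reduced. Then there is a $G$-equivariant isomorphism between $T$ and $T'$, and this isomorphism is unique.
   Context: A $G$-tree is a simplicial tree with a simplicial action of the group $G$ without inversions (no element exchanges the two endpoints of an edge). For a vertex $v$ (resp. an edge $e$), $G_v$ (resp. $G_e$) denotes its stabilizer in $G$. Edges are unoriented. Minimal: the $G$-tree has no proper $G$-invariant subtree. Elliptic: a subgroup $H<G$ is elliptic in a $G$-tree $T$ if it fixes a point of $T$ (equivalently a vertex, since there are no inversions). Strongly slide-free: whenever two edges $e_1,e_2$ having a common vertex $v$ are such that $G_{e_1}\subset G_{e_2}$, then $e_1$ and $e_2$ are in the same orbit under $G_v$. Reduced: one cannot perform a collapse move on the $G$-tree, i.e. for each edge $e$ incident on some vertex $v$ such that $G_e=G_v$, the two endpoints of $e$ are in the same $G$-orbit. Deformation: for simplicial $G$-trees with cocompact action (equivalently, splittings of $G$ as finite graphs of groups), a collapse move consists in replacing an edge of the quotient graph of groups corresponding to an amalgamated product $A*_C C$ by a vertex with vertex group $A$. In terms of the tree: given an edge $e$ with an endpoint $v$ such that $G_e=G_v$ and whose two endpoints are in different $G$-orbits, each edge in the orbit $G\cdot e$ is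 collapsed to a point. An expansion move is the inverse operation. A deformation is a finite sequence of collapse and expansion moves. The deformation space of a $G$-tree $T$ is the set of all $G$-trees $T'$ which can be deformed into $T$. (By a theorem of Forester, two cocompact simplicial $G$-trees can be deformed into one another if and only if they have the same elliptic subgroups.) Isomorphism means isomorphism of simplicial trees. *)

theory Defs
  imports "HOL-Algebra.Group_Action"
begin

section \<open>Simplicial trees\<close>

text \<open>
  An edge is the two-element set of its endpoints: a tree has neither loops nor multiple
  edges, so nothing is lost. The empty graph is not a tree.
\<close>

definition simplicial_tree :: "'v set \<Rightarrow> 'v set set \<Rightarrow> bool" where
  "simplicial_tree V E \<longleftrightarrow>
     V \<noteq> {} \<and>
     E \<subseteq> {{u, v} | u v. u \<in> V \<and> v \<in> V \<and> u \<noteq> v} \<and>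
     (\<forall>u\<in>V. \<forall>v\<in>V. (u, v) \<in> {(x, y). {x, y} \<in> E}\<^sup>*) \<and>
     \<not> (\<exists>c. 3 \<le> length c \<and> distinct c \<and> successively (\<lambda>x y. {x, y} \<in> E) c \<and>
            {last c, hd c} \<in> E)"

section \<open>Trees with a group action\<close>

record ('g, 'v) gtree =
  verts :: "'v set"
  edges :: "'v set set"
  act :: "'g \<Rightarrow> 'v \<Rightarrow> 'v"

abbreviation edge_act :: "('g, 'v) gtree \<Rightarrow> 'g \<Rightarrow> 'v set \<Rightarrow> 'v set" where
  "edge_act T g e \<equiv> act T g ` e"

definition is_gtree :: "('g, 'm) monoid_scheme \<Rightarrow> ('g, 'v) gtree \<Rightarrow> bool" where
  "is_gtree G T \<longleftrightarrow>
     simplicial_tree (verts T) (edges T) \<and>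
     group_action G (verts T) (act T) \<and>
     (\<forall>g\<in>carrier G. \<forall>e\<in>edges T. edge_act T g e \<in> edges T) \<and>
     \<not> (\<exists>g\<in>carrier G. \<exists>u v. {u, v} \<in> edges T \<and> act T g u = v \<and> act T g v = u)"

abbreviation vertex_stab :: "('g, 'm) monoid_scheme \<Rightarrow> ('g, 'v) gtree \<Rightarrow> 'v \<Rightarrow> 'g set" where
  "vertex_stab G T v \<equiv> stabilizer G (act T) v"

abbreviation edge_stab :: "('g, 'm) monoid_scheme \<Rightarrow> ('g, 'v) gtree \<Rightarrow> 'v set \<Rightarrow> 'g set" where
  "edge_stab G T e \<equiv> stabilizer G (edge_act T) e"

definition cocompact :: "('g, 'm) monoid_scheme \<Rightarrow> ('g, 'v) gtree \<Rightarrow> bool" where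
  "cocompact G T \<longleftrightarrow>
     finite (orbits G (verts T) (act T)) \<and> finite (orbits G (edges T) (edge_act T))"

definition minimal_gtree :: "('g, 'm) monoid_scheme \<Rightarrow> ('g, 'v) gtree \<Rightarrow> bool" where
  "minimal_gtree G T \<longleftrightarrow>
     (\<forall>V E. V \<subseteq> verts T \<and> E \<subseteq> edges T \<and> simplicial_tree V E \<and>
            (\<forall>g\<in>carrier G. (\<forall>v\<in>V. act T g v \<in> V) \<and> (\<forall>e\<in>E. edge_act T g e \<in> E))
        \<longrightarrow> V = verts T \<and> E = edges T)"

definition elliptic :: "('g, 'm) monoid_scheme \<Rightarrow> ('g, 'v) gtree \<Rightarrow> 'g set \<Rightarrow> bool" where
  "elliptic G T H \<longleftrightarrow> subgroup H G \<and> (\<exists>v\<in>verts T. \<forall>h\<in>H. act T h v = v)"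

definition strongly_slide_free :: "('g, 'm) monoid_scheme \<Rightarrow> ('g, 'v) gtree \<Rightarrow> bool" where
  "strongly_slide_free G T \<longleftrightarrow>
     (\<forall>e1\<in>edges T. \<forall>e2\<in>edges T. \<forall>v. v \<in> e1 \<and> v \<in> e2 \<and> edge_stab G T e1 \<subseteq> edge_stab G T e2
        \<longrightarrow> (\<exists>g\<in>vertex_stab G T v. edge_act T g e1 = e2))"

definition reduced :: "('g, 'm) monoid_scheme \<Rightarrow> ('g, 'v) gtree \<Rightarrow> bool" where
  "reduced G T \<longleftrightarrow>
     (\<forall>v w. {v, w} \<in> edges T \<and> edge_stab G T {v, w} = vertex_stab G T v
        \<longrightarrow> w \<in> orbit G (act T) v)"

text \<open>
  A simplicial isomorphism is determined by its values on vertices. It is required to be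
  extensional, so that uniqueness can be stated as an equality of functions.
\<close>

definition gtree_iso ::
    "('g, 'm) monoid_scheme \<Rightarrow> ('g, 'v) gtree \<Rightarrow> ('g, 'w) gtree \<Rightarrow> ('v \<Rightarrow> 'w) \<Rightarrow> bool" where
  "gtree_iso G T T' f \<longleftrightarrow>
     f \<in> extensional (verts T) \<and>
     bij_betw f (verts T) (verts T') \<and>
     (\<lambda>e. f ` e) ` edges T = edges T' \<and>
     (\<forall>g\<in>carrier G. \<forall>v\<in>verts T. f (act T g v) = act T' g (f v))"

section \<open>Deformation spaces\<close>

definition collapse_rel ::
    "('g, 'm) monoid_scheme \<Rightarrow> ('g, 'v) gtree \<Rightarrow> 'v set \<Rightarrow> ('v \<times> 'v) set" where
  "collapse_rel G T e =
     {(x, y). x \<in> verts T \<and> y \<in> verts T \<and>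
              (x, y) \<in> {(a, b). {a, b} \<in> orbit G (edge_act T) e}\<^sup>*}"

definition collapse ::
    "('g, 'm) monoid_scheme \<Rightarrow> ('g, 'v) gtree \<Rightarrow> 'v set \<Rightarrow> ('g, 'v set) gtree" where
  "collapse G T e =
     \<lparr> verts = verts T // collapse_rel G T e,
       edges = {(\<lambda>x. collapse_rel G T e `` {x}) ` d | d. d \<in> edges T - orbit G (edge_act T) e},
       act = (\<lambda>g. \<lambda>C \<in> verts T // collapse_rel G T e. act T g ` C) \<rparr>"

definition collapse_move ::
    "('g, 'm) monoid_scheme \<Rightarrow> ('g, 'v) gtree \<Rightarrow> ('g, 'w) gtree \<Rightarrow> bool" where
  "collapse_move G T T' \<longleftrightarrow>
     is_gtree G T \<and> cocompact G T \<and> is_gtree G T' \<and> cocompact G T' \<and>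
     (\<exists>v w. {v, w} \<in> edges T \<and> edge_stab G T {v, w} = vertex_stab G T v \<and>
            w \<notin> orbit G (act T) v \<and>
            (\<exists>f. gtree_iso G (collapse G T {v, w}) T' f))"

text \<open>
  The trees of a deformation are only relevant up to equivariant isomorphism. The intermediate
  ones are taken with vertices in the fixed type \<open>nat \<times> 'g set\<close>, in order that a deformation
  may relate trees over different vertex types and is not constrained by their size; the
  lemma \<open>cocompact_gtree_model\<close> below shows that this is no restriction.
\<close>

definition deforms_to ::
    "('g, 'm) monoid_scheme \<Rightarrow> ('g, 'v) gtree \<Rightarrow> ('g, 'w) gtree \<Rightarrow> bool" where
  "deforms_to G T T' \<longleftrightarrow>
     (\<exists>S S' :: ('g, nat \<times> 'g set) gtree.
        is_gtree G S \<and> cocompact G S \<and> is_gtree G S' \<and> cocompact G S' \<and>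
        (\<exists>f. gtree_iso G T S f) \<and>
        (\<lambda>A B. collapse_move G A B \<or> collapse_move G B A)\<^sup>*\<^sup>* S S' \<and>
        (\<exists>f. gtree_iso G S' T' f))"

definition deformation_space ::
    "('g, 'm) monoid_scheme \<Rightarrow> ('g, 'v) gtree \<Rightarrow> ('g, 'w) gtree set" where
  "deformation_space G T =
     {T'. is_gtree G T' \<and> cocompact G T' \<and> deforms_to G T' T}"

subsection \<open>The vertex type of the intermediate trees\<close>

definition transport :: "('g, 'v) gtree \<Rightarrow> ('v \<Rightarrow> 'w) \<Rightarrow> ('g, 'w) gtree" where
  "transport T f =
     \<lparr> verts = f ` verts T,
       edges = (\<lambda>e. f ` e) ` edges T,
       act = (\<lambda>g. \<lambda>y \<in> f ` verts T. f (act T g (inv_into (verts T) f y))) \<rparr>"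

lemma simplicial_tree_image:
  assumes t: "simplicial_tree V E" and inj: "inj_on f V"
  shows "simplicial_tree (f ` V) ((\<lambda>e. f ` e) ` E)"
proof -
  let ?E = "(\<lambda>e. f ` e) ` E"
  let ?i = "inv_into V f"
  have E: "E \<subseteq> {{u, v} | u v. u \<in> V \<and> v \<in> V \<and> u \<noteq> v}"
    and ne: "V \<noteq> {}"
    and conn: "\<And>u v. u \<in> V \<Longrightarrow> v \<in> V \<Longrightarrow> (u, v) \<in> {(x, y). {x, y} \<in> E}\<^sup>*"
    and acyc: "\<not> (\<exists>c. 3 \<le> length c \<and> distinct c \<and> successively (\<lambda>x y. {x, y} \<in> E) c \<and>
            {last c, hd c} \<in> E)"
    using t unfolding simplicial_tree_def by auto
  have EV: "e \<subseteq> V" if "e \<in> E" for e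
    using E that by auto
  have bk: "?i x \<in> V \<and> x \<in> f ` V \<and> y \<in> f ` V \<and> {?i x, ?i y} \<in> E" if xy: "{x, y} \<in> ?E" for x y
  proof -
    obtain e where e: "e \<in> E" "{x, y} = f ` e" using xy by auto
    have "?i ` f ` e = e"
      using inv_into_image_cancel[OF inj EV[OF e(1)]] .
    hence "{?i x, ?i y} = e" using e(2) by (metis image_empty image_insert)
    moreover have "{x, y} \<subseteq> f ` V" using e EV by auto
    ultimately show ?thesis using e(1) by (auto intro: inv_into_into)
  qed
  have "?E \<subseteq> {{u, v} | u v. u \<in> f ` V \<and> v \<in> f ` V \<and> u \<noteq> v}"
  proof
    fix d assume "d \<in> ?E"
    then obtain e where e: "e \<in> E" "d = f ` e" by auto
    then obtain u v where uv: "e = {u, v}" "u \<in> V" "v \<in> V" "u \<noteq> v" using E by auto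
    hence "f u \<noteq> f v" using inj by (auto simp: inj_on_def)
    with uv e show "d \<in> {{u, v} | u v. u \<in> f ` V \<and> v \<in> f ` V \<and> u \<noteq> v}" by auto
  qed
  moreover have "(f u, f v) \<in> {(x, y). {x, y} \<in> ?E}\<^sup>*" if uv: "u \<in> V" "v \<in> V" for u v
    using conn[OF uv]
  proof (induction rule: rtrancl_induct)
    case (step y z)
    have "f ` {y, z} \<in> ?E" using step.hyps by blast
    hence "(f y, f z) \<in> {(x, y). {x, y} \<in> ?E}" by simp
    with step.IH show ?case by (rule rtrancl_into_rtrancl)
  qed simp
  moreover have "\<not> (\<exists>c. 3 \<le> length c \<and> distinct c \<and> successively (\<lambda>x y. {x, y} \<in> ?E) c \<and>
            {last c, hd c} \<in> ?E)"
  proof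
    assume "\<exists>c. 3 \<le> length c \<and> distinct c \<and> successively (\<lambda>x y. {x, y} \<in> ?E) c \<and>
            {last c, hd c} \<in> ?E"
    then obtain c where c: "3 \<le> length c" "distinct c" "successively (\<lambda>x y. {x, y} \<in> ?E) c"
      "{last c, hd c} \<in> ?E" by auto
    have "set xs \<subseteq> f ` V"
      if "successively (\<lambda>x y. {x, y} \<in> ?E) xs" "last xs \<in> f ` V" for xs
      using that
    proof (induction xs rule: induct_list012)
      case (3 x y zs)
      have "{x, y} \<in> ?E" using "3.prems"(1) by simp
      moreover have "set (y # zs) \<subseteq> f ` V" using 3 by simp
      ultimately show ?case using bk by auto
    qed auto
    moreover have "last c \<in> f ` V" using bk[OF c(4)] by blast
    ultimately have "set c \<subseteq> f ` V" using c(3) by blast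
    hence inj': "inj_on ?i (set c)" by (rule inj_on_inv_into)
    let ?c = "map ?i c"
    have "distinct ?c" using c(2) inj' by (simp add: distinct_map)
    moreover have "successively (\<lambda>x y. {x, y} \<in> E) ?c"
      unfolding successively_map by (rule successively_mono[OF c(3)]) (use bk in blast)
    moreover have "c \<noteq> []" using c(1) by auto
    hence "{last ?c, hd ?c} \<in> E" using bk[OF c(4)] by (simp add: last_map hd_map)
    moreover have "3 \<le> length ?c" using c(1) by simp
    ultimately show False using acyc by blast
  qed
  ultimately show ?thesis
    unfolding simplicial_tree_def using ne by blast
qed


lemma is_gtree_transport:
  assumes T: "is_gtree G T" and inj: "inj_on f (verts T)"
  shows "is_gtree G (transport T f)"
    and "gtree_iso G T (transport T f) (restrict f (verts T))"
    and "cocompact G T \<Longrightarrow> cocompact G (transport T f)"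
proof -
  let ?V = "verts T" and ?E = "edges T" and ?S = "transport T f"
  let ?i = "inv_into ?V f"
  interpret group_action G ?V "act T" using T by (simp add: is_gtree_def)
  have grp: "group G" using group_hom by (simp add: group_hom_def)
  have tree: "simplicial_tree ?V ?E" using T by (simp add: is_gtree_def)
  have EV: "e \<subseteq> ?V" if "e \<in> ?E" for e
    using tree that unfolding simplicial_tree_def by auto
  have closed: "act T g x \<in> ?V" if "g \<in> carrier G" "x \<in> ?V" for g x
    using surj_prop[OF that(1)] that(2) by auto
  have act: "act ?S g (f x) = f (act T g x)" if "x \<in> ?V" for g x
    using that inj by (simp add: transport_def)
  have eact: "edge_act ?S g (f ` e) = f ` edge_act T g e" if "e \<subseteq> ?V" for g e
    unfolding image_image by (rule image_cong) (use that act in auto)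
  have bij: "act ?S g \<in> Bij (f ` ?V)" if g: "g \<in> carrier G" for g
  proof -
    have "act ?S g ` f ` ?V = f ` ?V"
      unfolding eact[OF subset_refl] surj_prop[OF g] ..
    moreover have "inj_on (act ?S g) (f ` ?V)"
    proof (rule inj_onI, clarify)
      fix x y assume xy: "x \<in> ?V" "y \<in> ?V" "act ?S g (f x) = act ?S g (f y)"
      hence "act T g x = act T g y"
        using inj closed[OF g] by (simp add: act inj_on_eq_iff)
      thus "f x = f y" using inj_prop[OF g] xy by (simp add: inj_on_eq_iff)
    qed
    moreover have "act ?S g \<in> extensional (f ` ?V)" by (simp add: transport_def)
    ultimately show ?thesis by (simp add: Bij_def bij_betw_def)
  qed
  have ga: "group_action G (verts ?S) (act ?S)"
  proof -
    have "act ?S \<in> hom G (BijGroup (f ` ?V))"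
    proof (rule homI)
      fix g assume "g \<in> carrier G"
      thus "act ?S g \<in> carrier (BijGroup (f ` ?V))" using bij by (simp add: BijGroup_def)
    next
      fix g h assume gh: "g \<in> carrier G" "h \<in> carrier G"
      have "act ?S (g \<otimes>\<^bsub>G\<^esub> h) = compose (f ` ?V) (act ?S g) (act ?S h)"
      proof (rule extensionalityI[of _ "f ` ?V"])
        show "act ?S (g \<otimes>\<^bsub>G\<^esub> h) \<in> extensional (f ` ?V)" by (simp add: transport_def)
        fix y assume "y \<in> f ` ?V"
        then obtain x where x: "x \<in> ?V" "y = f x" by auto
        show "act ?S (g \<otimes>\<^bsub>G\<^esub> h) y = compose (f ` ?V) (act ?S g) (act ?S h) y"
          using x gh closed by (simp add: act compose_eq composition_rule)
      qed simp
      thus "act ?S (g \<otimes>\<^bsub>G\<^esub> h) = act ?S g \<otimes>\<^bsub>BijGroup (f ` ?V)\<^esub> act ?S h"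
        using gh bij by (simp add: BijGroup_def)
    qed
    thus ?thesis
      using grp group_BijGroup
      by (simp add: group_action_def group_hom_def group_hom_axioms_def transport_def)
  qed
  show "is_gtree G ?S"
    unfolding is_gtree_def
  proof (intro conjI ballI notI)
    show "simplicial_tree (verts ?S) (edges ?S)"
      using simplicial_tree_image[OF tree inj] by (simp add: transport_def)
    show "group_action G (verts ?S) (act ?S)" by (rule ga)
    fix g d assume g: "g \<in> carrier G" and "d \<in> edges ?S"
    then obtain e where e: "e \<in> ?E" "d = f ` e" by (auto simp: transport_def)
    hence "edge_act T g e \<in> ?E" using T g by (simp add: is_gtree_def)
    thus "edge_act ?S g d \<in> edges ?S"
      using e EV eact[of e g] by (auto simp: transport_def)
  next
    assume "\<exists>g\<in>carrier G. \<exists>u v. {u, v} \<in> edges ?S \<and> act ?S g u = v \<and> act ?S g v = u"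
    then obtain g u v where g: "g \<in> carrier G"
      and uv: "{u, v} \<in> edges ?S" "act ?S g u = v" "act ?S g v = u" by auto
    then obtain e where e: "e \<in> ?E" "{u, v} = f ` e" by (auto simp: transport_def)
    then obtain x y where xy: "e = {x, y}" "x \<in> ?V" "y \<in> ?V"
      using tree unfolding simplicial_tree_def by blast
    hence "act ?S g (f x) = f y \<and> act ?S g (f y) = f x"
      using e uv by (auto simp: doubleton_eq_iff)
    hence "act T g x = y \<and> act T g y = x"
      using xy inj closed[OF g] by (simp add: act inj_on_eq_iff)
    thus False using T g e xy by (auto simp: is_gtree_def)
  qed
  show "gtree_iso G T ?S (restrict f ?V)"
    unfolding gtree_iso_def
  proof (intro conjI ballI)
    show "bij_betw (restrict f ?V) ?V (verts ?S)"
      using inj by (simp add: bij_betw_def transport_def)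
    have "restrict f ?V ` e = f ` e" if "e \<in> ?E" for e
      by (rule image_cong) (use EV[OF that] in auto)
    thus "(`) (restrict f ?V) ` ?E = edges ?S" by (simp add: transport_def)
    fix g v assume "g \<in> carrier G" "v \<in> ?V"
    thus "restrict f ?V (act T g v) = act ?S g (restrict f ?V v)"
      using closed by (simp add: act)
  qed simp
  assume co: "cocompact G T"
  have "orbits G (verts ?S) (act ?S) = (\<lambda>X. f ` X) ` orbits G ?V (act T)"
  proof -
    have "orbit G (act ?S) (f x) = f ` orbit G (act T) x" if "x \<in> ?V" for x
      using that by (auto simp: orbit_def act)
    thus ?thesis by (force simp: orbits_def transport_def)
  qed
  moreover have "orbits G (edges ?S) (edge_act ?S) = (\<lambda>X. (\<lambda>e. f ` e) ` X) ` orbits G ?E (edge_act T)"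
  proof -
    have "orbit G (edge_act ?S) (f ` e) = (\<lambda>e. f ` e) ` orbit G (edge_act T) e" if "e \<in> ?E" for e
      using eact[OF EV[OF that]] by (auto simp: orbit_def)
    thus ?thesis by (force simp: orbits_def transport_def)
  qed
  ultimately show "cocompact G ?S" using co by (simp add: cocompact_def)
qed

lemma cocompact_gtree_model:
  fixes T :: "('g, 'v) gtree"
  assumes T: "is_gtree G T" and co: "cocompact G T"
  shows "\<exists>(S :: ('g, nat \<times> 'g set) gtree) f. is_gtree G S \<and> cocompact G S \<and> gtree_iso G T S f"
proof -
  interpret group_action G "verts T" "act T" using T by (simp add: is_gtree_def)
  let ?orb = "orbit G (act T)"
  have "finite (orbits G (verts T) (act T))" using co by (simp add: cocompact_def)
  then obtain idx :: "'v set \<Rightarrow> nat" where idx: "inj_on idx (orbits G (verts T) (act T))"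
    using finite_imp_inj_to_nat_seg by blast
  define r where "r X = (SOME x. x \<in> verts T \<and> ?orb x = X)" for X
  define F where "F x = (idx (?orb x), {g \<in> carrier G. act T g (r (?orb x)) = x})" for x
  have r: "r (?orb x) \<in> verts T \<and> ?orb (r (?orb x)) = ?orb x" if "x \<in> verts T" for x
    unfolding r_def by (rule someI[of _ x]) (use that in simp)
  have ne: "\<exists>g\<in>carrier G. act T g (r (?orb x)) = x" if "x \<in> verts T" for x
  proof -
    have "x \<in> ?orb x" using orbit_refl[OF that] .
    hence "x \<in> ?orb (r (?orb x))" using r[OF that] by simp
    thus ?thesis unfolding orbit_def[of _ _ "r _"] by (simp add: image_iff) metis
  qed
  have "inj_on F (verts T)"
  proof (rule inj_onI)
    fix x y assume xy: "x \<in> verts T" "y \<in> verts T" "F x = F y"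
    hence "?orb x = ?orb y"
      using idx by (auto simp: F_def orbits_def inj_on_def)
    moreover obtain g where "g \<in> carrier G" "act T g (r (?orb x)) = x" using ne[OF xy(1)] by auto
    ultimately show "x = y" using xy(3) by (auto simp: F_def)
  qed
  thus ?thesis using is_gtree_transport[OF T] co by blast
qed

end

theory Submission
  imports Defs
begin

text \<open>
  Write \<open>G\<^sub>v\<close> for a vertex stabilizer. The isomorphism is read off from stabilizers. In a minimal
  strongly slide-free tree an inclusion \<open>G\<^sub>v \<subseteq> G\<^sub>w\<close> forces \<open>v = w\<close>: the first edge from \<open>v\<close> to \<open>w\<close>
  would have stabilizer \<open>G\<^sub>v\<close>, every other edge at \<open>v\<close> would be slid onto it by an element of \<open>G\<^sub>v\<close>,
  and \<open>v\<close> would be a leaf (\<open>slide_free_stab_maximal\<close>). So the vertices of \<open>T\<close> correspond to the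
  maximal elliptic subgroups. As the elliptic subgroups of \<open>T'\<close> are the same and \<open>T'\<close> is reduced,
  each \<open>G\<^sub>v\<close> is the stabilizer of exactly one vertex \<open>f v\<close> of \<open>T'\<close>. The map \<open>f\<close> is equivariant and
  injective, and every equivariant isomorphism agrees with it, which gives uniqueness. It remains to
  see that \<open>f\<close> is surjective and respects edges.

  The main point is that \<open>f\<close> does not decrease distances (\<open>f_expands\<close>). Every stabilizer in \<open>T'\<close> is
  contained in one of \<open>T\<close>, so the geodesic from \<open>f x\<close> to \<open>f v\<close> can be sent back to \<open>T\<close> step by step;
  if \<open>{x, v}\<close> is an edge, the returned path crosses it, so that some edge of the geodesic, called a
  core edge, has stabilizer inside \<open>G\<^sub>x \<inter> G\<^sub>v\<close>. When the images of two edges \<open>{v, x}\<close> and \<open>{v, y}\<close>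
  share an initial segment, slide-freeness gives \<open>k\<close> in \<open>G\<^sub>v\<close> with \<open>k x = y\<close>, and \<open>k\<close> fixes
  the shared segment. Since \<open>k\<close> moves \<open>x\<close>, it does not fix a core edge, so the core edges lie outside
  of what is folded together. The image of a geodesic of length \<open>n\<close> thus keeps \<open>n\<close> core edges after
  backtracking is removed.

  Surjectivity (\<open>f_surj\<close>): a vertex \<open>u\<close> outside of the image has, \<open>T'\<close> being reduced, a neighbour
  \<open>g u\<close> with \<open>G\<^sub>u \<subseteq> G\<^bsub>g u\<^esub>\<close>, so \<open>g\<close> translates \<open>T'\<close> along an axis by one and the stabilizers grow
  along it. By the distance bound \<open>g\<close> translates \<open>T\<close> by one as well, and comparing the two axes gives
  consecutive edges \<open>{a, g a}\<close> and \<open>{g a, g\<^sup>2 a}\<close> whose stabilizers are nested. Slide-freeness yields \<open>k\<close>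
  fixing \<open>g a\<close> with \<open>k a = g\<^sup>2 a\<close>, and then \<open>g\<inverse> k\<close> inverts the edge \<open>{a, g a}\<close>.

  For the first part, a collapse does not change the elliptic subgroups (\<open>collapse_elliptic\<close>), and a
  minimal strongly slide-free tree is reduced.
\<close>

section \<open>Walks and distances in trees\<close>

definition walk :: "'v set set \<Rightarrow> (nat \<Rightarrow> 'v) \<Rightarrow> nat \<Rightarrow> bool" where
  "walk E p n \<longleftrightarrow> (\<forall>i<n. {p i, p (Suc i)} \<in> E)"

definition reduced_walk :: "'v set set \<Rightarrow> (nat \<Rightarrow> 'v) \<Rightarrow> nat \<Rightarrow> bool" where
  "reduced_walk E p n \<longleftrightarrow> walk E p n \<and> (\<forall>i. Suc i < n \<longrightarrow> p i \<noteq> p (Suc (Suc i)))"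

definition walk_append :: "nat \<Rightarrow> (nat \<Rightarrow> 'v) \<Rightarrow> (nat \<Rightarrow> 'v) \<Rightarrow> nat \<Rightarrow> 'v" where
  "walk_append n p q i = (if i \<le> n then p i else q (i - n))"

definition tdist :: "'v set set \<Rightarrow> 'v \<Rightarrow> 'v \<Rightarrow> nat" where
  "tdist E x y = (LEAST n. \<exists>p. walk E p n \<and> p 0 = x \<and> p n = y)"

definition between :: "'v set set \<Rightarrow> 'v \<Rightarrow> 'v \<Rightarrow> 'v \<Rightarrow> bool" where
  "between E x z y \<longleftrightarrow> tdist E x y = tdist E x z + tdist E z y"

lemma walk_append_walk:
  assumes "walk E p n" "walk E q m" "p n = q 0"
  shows "walk E (walk_append n p q) (n + m)"
  unfolding walk_def
proof (intro allI impI)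
  fix i assume i: "i < n + m"
  consider "i < n" | "i = n" | "i > n" by linarith
  thus "{walk_append n p q i, walk_append n p q (Suc i)} \<in> E"
  proof cases
    case 1 thus ?thesis using assms by (simp add: walk_append_def walk_def)
  next
    case 2 thus ?thesis using assms i by (simp add: walk_append_def walk_def)
  next
    case 3
    hence "i - n < m" "Suc i - n = Suc (i - n)" using i by auto
    thus ?thesis using assms 3 by (simp add: walk_append_def walk_def)
  qed
qed

lemma walk_append_ends:
  "walk_append n p q 0 = p 0" "p n = q 0 \<Longrightarrow> walk_append n p q (n + m) = q m"
  by (auto simp: walk_append_def)

lemma walk_rev: "walk E p n \<Longrightarrow> walk E (\<lambda>i. p (n - i)) n"
  unfolding walk_def
proof (intro allI impI)
  fix i assume w: "\<forall>i<n. {p i, p (Suc i)} \<in> E" and i: "i < n"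
  have "n - i = Suc (n - Suc i)" using i by simp
  thus "{p (n - i), p (n - Suc i)} \<in> E"
    using w i by (metis diff_less insert_commute less_nat_zero_code neq0_conv zero_less_Suc)
qed

lemma reduced_walk_rev:
  assumes "reduced_walk E p n"
  shows "reduced_walk E (\<lambda>i. p (n - i)) n"
  unfolding reduced_walk_def
proof (intro conjI allI impI)
  show "walk E (\<lambda>i. p (n - i)) n" using assms walk_rev by (auto simp: reduced_walk_def)
  fix i assume i: "Suc i < n"
  have "n - i = Suc (Suc (n - Suc (Suc i)))" "Suc (n - Suc (Suc i)) < n" using i by auto
  thus "p (n - i) \<noteq> p (n - Suc (Suc i))"
    using assms unfolding reduced_walk_def by metis
qed

lemma reduced_walk_append:
  assumes p: "reduced_walk E p n" and q: "reduced_walk E q m" and e: "p n = q 0"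
    and turn: "0 < n \<Longrightarrow> 0 < m \<Longrightarrow> p (n - 1) \<noteq> q 1"
  shows "reduced_walk E (walk_append n p q) (n + m)"
  unfolding reduced_walk_def
proof (intro conjI allI impI)
  show "walk E (walk_append n p q) (n + m)"
    using walk_append_walk p q e by (auto simp: reduced_walk_def)
  fix i assume i: "Suc i < n + m"
  consider "Suc i < n" | "Suc i = n" | "i \<ge> n" by linarith
  thus "walk_append n p q i \<noteq> walk_append n p q (Suc (Suc i))"
  proof cases
    case 1 thus ?thesis using p by (simp add: walk_append_def reduced_walk_def)
  next
    case 2
    thus ?thesis using turn i by (auto simp: walk_append_def)
  next
    case 3
    hence "Suc (i - n) < m" "Suc (Suc i) - n = Suc (Suc (i - n))" using i by auto
    hence "q (i - n) \<noteq> q (Suc (Suc i) - n)" using q by (simp add: reduced_walk_def)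
    moreover have "walk_append n p q i = q (i - n)" using 3 e by (auto simp: walk_append_def)
    moreover have "walk_append n p q (Suc (Suc i)) = q (Suc (Suc i) - n)"
      using 3 by (auto simp: walk_append_def)
    ultimately show ?thesis by simp
  qed
qed

lemma walk_take: "walk E p n \<Longrightarrow> m \<le> n \<Longrightarrow> walk E p m"
  by (auto simp: walk_def)

lemma reduced_walk_take: "reduced_walk E p n \<Longrightarrow> m \<le> n \<Longrightarrow> reduced_walk E p m"
  by (auto simp: reduced_walk_def walk_def)

lemma reduced_walk_drop: "reduced_walk E p n \<Longrightarrow> m \<le> n \<Longrightarrow> reduced_walk E (\<lambda>i. p (m + i)) (n - m)"
  by (auto simp: reduced_walk_def walk_def)

lemma tdist_le: "walk E p n \<Longrightarrow> tdist E (p 0) (p n) \<le> n"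
  unfolding tdist_def by (rule Least_le) auto

locale tree =
  fixes V :: "'v set" and E :: "'v set set"
  assumes tree: "simplicial_tree V E"
begin

abbreviation d where "d \<equiv> tdist E"
abbreviation B where "B \<equiv> between E"

lemma edge_verts:
  assumes "{x, y} \<in> E" shows "x \<in> V" "y \<in> V" "x \<noteq> y"
proof -
  obtain u v where "{x, y} = {u, v}" "u \<in> V" "v \<in> V" "u \<noteq> v"
    using tree assms unfolding simplicial_tree_def by blast
  thus "x \<in> V" "y \<in> V" "x \<noteq> y" by (auto simp: doubleton_eq_iff)
qed

lemma walk_verts:
  assumes "walk E p n" "p 0 \<in> V" "i \<le> n" shows "p i \<in> V"
proof (cases i)
  case (Suc j)
  thus ?thesis using assms edge_verts(2)[of "p j" "p (Suc j)"] by (simp add: walk_def)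
qed (use assms in simp)

lemma ex_walk:
  assumes "x \<in> V" "y \<in> V"
  shows "\<exists>n p. walk E p n \<and> p 0 = x \<and> p n = y"
proof -
  have "(x, y) \<in> {(x, y). {x, y} \<in> E}\<^sup>*" using tree assms by (simp add: simplicial_tree_def)
  thus ?thesis
  proof (induction rule: rtrancl_induct)
    case base
    have "walk E (\<lambda>_. x) 0" by (simp add: walk_def)
    thus ?case by blast
  next
    case (step y z)
    then obtain n p where p: "walk E p n" "p 0 = x" "p n = y" by blast
    have q: "walk E (\<lambda>i. if i = 0 then y else z) 1" using step by (simp add: walk_def)
    show ?case
      using walk_append_walk[OF p(1) q] walk_append_ends(1)[of n p]
        walk_append_ends(2)[of p n "\<lambda>i. if i = 0 then y else z" 1] p
      by (metis (mono_tags, lifting) one_neq_zero)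
  qed
qed

lemma ex_geodesic:
  assumes "x \<in> V" "y \<in> V"
  shows "\<exists>p. walk E p (d x y) \<and> p 0 = x \<and> p (d x y) = y"
  unfolding tdist_def by (rule LeastI_ex) (rule ex_walk[OF assms])

lemma d_refl [simp]: "d x x = 0"
  using tdist_le[of E "\<lambda>_. x" 0] by (simp add: walk_def)

lemma d_eq_0 [simp]: "x \<in> V \<Longrightarrow> y \<in> V \<Longrightarrow> d x y = 0 \<longleftrightarrow> x = y"
  using ex_geodesic[of x y] by auto

lemma d_sym: assumes "x \<in> V" "y \<in> V" shows "d x y = d y x"
proof -
  have "d b a \<le> d a b" if ab: "a \<in> V" "b \<in> V" for a b
  proof -
    obtain p where p: "walk E p (d a b)" "p 0 = a" "p (d a b) = b"
      using ex_geodesic[OF ab] by blast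
    show ?thesis using tdist_le[OF walk_rev[OF p(1)]] p by simp
  qed
  thus ?thesis using assms by (simp add: order_antisym)
qed

lemma d_triangle:
  assumes "x \<in> V" "y \<in> V" "z \<in> V" shows "d x z \<le> d x y + d y z"
proof -
  obtain p where p: "walk E p (d x y)" "p 0 = x" "p (d x y) = y"
    using ex_geodesic[OF assms(1,2)] by blast
  obtain q where q: "walk E q (d y z)" "q 0 = y" "q (d y z) = z"
    using ex_geodesic[OF assms(2,3)] by blast
  have "walk E (walk_append (d x y) p q) (d x y + d y z)"
    by (rule walk_append_walk) (use p q in simp_all)
  from tdist_le[OF this] show ?thesis
    using p q walk_append_ends(1)[of "d x y" p q] walk_append_ends(2)[of p "d x y" q "d y z"] by simp
qed

lemma d_eq_1: assumes "x \<in> V" "y \<in> V" shows "d x y = 1 \<longleftrightarrow> {x, y} \<in> E"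
proof
  assume 1: "d x y = 1"
  obtain p where "walk E p (d x y)" "p 0 = x" "p (d x y) = y"
    using ex_geodesic[OF assms] by blast
  thus "{x, y} \<in> E" unfolding 1 by (auto simp: walk_def)
next
  assume e: "{x, y} \<in> E"
  have "walk E (\<lambda>i. if i = 0 then x else y) 1" using e by (simp add: walk_def)
  from tdist_le[OF this] have "d x y \<le> 1" by simp
  moreover have "d x y \<noteq> 0" using assms edge_verts(3)[OF e] by simp
  ultimately show "d x y = 1" by simp
qed

lemma geodesic_reduced:
  assumes w: "walk E p n" and n: "d (p 0) (p n) = n"
  shows "reduced_walk E p n"
  unfolding reduced_walk_def
proof (intro conjI allI impI w notI)
  fix i assume i: "Suc i < n" and eq: "p i = p (Suc (Suc i))"
  have w1: "walk E p i" using w i by (simp add: walk_def)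
  have w2: "walk E (\<lambda>j. p (Suc (Suc i) + j)) (n - Suc (Suc i))" using w i by (simp add: walk_def)
  let ?q = "walk_append i p (\<lambda>j. p (Suc (Suc i) + j))"
  have w: "walk E ?q (i + (n - Suc (Suc i)))"
    by (rule walk_append_walk[OF w1 w2]) (use eq in simp)
  have "?q (i + (n - Suc (Suc i))) = p (Suc (Suc i) + (n - Suc (Suc i)))"
    by (rule walk_append_ends(2)) (use eq in simp)
  also have "Suc (Suc i) + (n - Suc (Suc i)) = n" using i by simp
  finally have "d (p 0) (p n) \<le> i + (n - Suc (Suc i))"
    using tdist_le[OF w] by (simp add: walk_append_ends(1))
  thus False using n i by simp
qed

text \<open>
  A closed subwalk without a proper closed subwalk has distinct vertices, and it has length at least
  three because the walk does not backtrack; so it would be a cycle.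
\<close>

lemma reduced_walk_not_closed:
  "reduced_walk E p n \<Longrightarrow> 0 < n \<Longrightarrow> p 0 \<noteq> p n"
proof (induction n arbitrary: p rule: less_induct)
  case (less n)
  show ?case
  proof
    assume closed: "p 0 = p n"
    have w: "{p i, p (Suc i)} \<in> E" if "i < n" for i
      using less.prems that by (simp add: reduced_walk_def walk_def)
    have inj: "inj_on p {..<n}"
    proof (rule linorder_inj_onI)
      fix i j assume ij: "i < j" "i \<in> {..<n}" "j \<in> {..<n}"
      have "reduced_walk E (\<lambda>l. p (i + l)) (j - i)"
        using reduced_walk_drop[OF reduced_walk_take[OF less.prems(1), of j], of i] ij by simp
      from less.IH[OF _ this] show "p i \<noteq> p j" using ij by auto
    qed (auto simp: linorder_linear)
    have "n \<noteq> 1" using w[of 0] closed edge_verts(3) by fastforce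
    moreover have "n \<noteq> 2"
      using less.prems(1) closed by (auto simp: reduced_walk_def numeral_2_eq_2)
    ultimately have n: "3 \<le> n" using less.prems(2) by linarith
    let ?c = "map p [0..<n]"
    have "distinct ?c" using inj by (simp add: distinct_map atLeast0LessThan)
    moreover have "successively (\<lambda>x y. {x, y} \<in> E) ?c"
      unfolding successively_map successively_conv_nth using w by auto
    moreover have "{last ?c, hd ?c} \<in> E"
      using w[of "n - 1"] n closed by (simp add: last_map hd_map)
    moreover have "3 \<le> length ?c" using n by simp
    ultimately show False using tree unfolding simplicial_tree_def by blast
  qed
qed

lemma reduced_walk_length_unique:
  "reduced_walk E p n \<Longrightarrow> reduced_walk E q m \<Longrightarrow> p 0 = q 0 \<Longrightarrow> p n = q m \<Longrightarrow> n = m"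
proof (induction n arbitrary: m)
  case 0
  thus ?case using reduced_walk_not_closed[of q m] by auto
next
  case (Suc n)
  have m: "0 < m" using reduced_walk_not_closed[of p "Suc n"] Suc.prems by (cases m) auto
  show ?case
  proof (cases "p n = q (m - 1)")
    case True
    have "n = m - 1"
      by (rule Suc.IH) (use Suc.prems True m in \<open>auto intro: reduced_walk_take\<close>)
    thus ?thesis using m by simp
  next
    case False
    have "reduced_walk E (walk_append (Suc n) p (\<lambda>i. q (m - i))) (Suc n + m)"
      by (rule reduced_walk_append[OF Suc.prems(1) reduced_walk_rev[OF Suc.prems(2)]])
        (use False Suc.prems in auto)
    from reduced_walk_not_closed[OF this] have False
      using Suc.prems walk_append_ends(2)[of p "Suc n" "\<lambda>i. q (m - i)" m]
      by (simp add: walk_append_ends(1))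
    thus ?thesis ..
  qed
qed

lemma reduced_walk_geodesic:
  assumes "reduced_walk E p n" "p 0 \<in> V"
  shows "d (p 0) (p n) = n"
proof -
  have "p n \<in> V" using assms walk_verts by (auto simp: reduced_walk_def)
  then obtain q where q: "walk E q (d (p 0) (p n))" "q 0 = p 0" "q (d (p 0) (p n)) = p n"
    using ex_geodesic assms(2) by blast
  have "reduced_walk E q (d (p 0) (p n))" by (rule geodesic_reduced[OF q(1)]) (use q in simp)
  from reduced_walk_length_unique[OF this assms(1)] show ?thesis using q by simp
qed

lemma ex_step:
  assumes "x \<in> V" "m \<in> V" "x \<noteq> m"
  shows "\<exists>p. {m, p} \<in> E \<and> d x m = d x p + 1"
proof -
  obtain q where q: "walk E q (d x m)" "q 0 = x" "q (d x m) = m"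
    using ex_geodesic assms by blast
  have "d x m \<noteq> 0" using assms by simp
  then obtain k where k: "d x m = Suc k" by (cases "d x m") auto
  have e: "{m, q k} \<in> E" using q k by (auto simp: walk_def insert_commute)
  have "d x (q k) \<le> k" using tdist_le[OF walk_take[OF q(1), of k]] q k by simp
  moreover have "d x m \<le> d x (q k) + d (q k) m"
    using assms edge_verts[OF e] by (intro d_triangle)
  moreover have "d (q k) m = 1" using d_eq_1 e edge_verts[OF e] by (simp add: insert_commute)
  ultimately show ?thesis using e k by (intro exI[of _ "q k"]) simp
qed

text \<open>
  Two geodesics ending at \<open>m\<close> along different edges concatenate to a reduced walk, which is
  a geodesic. The remaining facts about betweenness all come from this one.
\<close>

lemma glue:
  assumes "x \<in> V" "y \<in> V" and p: "{m, p} \<in> E" "d x m = d x p + 1"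
    and q: "{m, q} \<in> E" "d y m = d y q + 1" and "p \<noteq> q"
  shows "d x y = d x m + d m y"
proof -
  have *: "\<exists>r. reduced_walk E r (d a m) \<and> r 0 = a \<and> r (d a m) = m \<and> r (d a m - 1) = b \<and> 0 < d a m"
    if a: "a \<in> V" and b: "{m, b} \<in> E" "d a m = d a b + 1" for a b
  proof -
    obtain r where r: "walk E r (d a b)" "r 0 = a" "r (d a b) = b"
      using ex_geodesic edge_verts[OF b(1)] a by blast
    let ?s = "\<lambda>i. if i = (0::nat) then b else m"
    have s: "walk E ?s 1" using b by (simp add: walk_def insert_commute)
    have w: "walk E (walk_append (d a b) r ?s) (d a m)"
      unfolding b(2) by (rule walk_append_walk[OF r(1) s]) (use r in simp)
    have ends: "walk_append (d a b) r ?s 0 = a" "walk_append (d a b) r ?s (d a m) = m"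
      "walk_append (d a b) r ?s (d a m - 1) = b"
      using r by (auto simp: walk_append_def b(2))
    moreover have "reduced_walk E (walk_append (d a b) r ?s) (d a m)"
      by (rule geodesic_reduced[OF w]) (simp add: ends)
    ultimately show ?thesis using b(2) by auto
  qed
  obtain r where r: "reduced_walk E r (d x m)" "r 0 = x" "r (d x m) = m" "r (d x m - 1) = p"
    using *[OF assms(1) p] by blast
  obtain s where s: "reduced_walk E s (d y m)" "s 0 = y" "s (d y m) = m" "s (d y m - 1) = q"
    using *[OF assms(2) q] by blast
  let ?w = "walk_append (d x m) r (\<lambda>i. s (d y m - i))"
  have "reduced_walk E ?w (d x m + d y m)"
    by (rule reduced_walk_append[OF r(1) reduced_walk_rev[OF s(1)]]) (use r s \<open>p \<noteq> q\<close> in auto)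
  from reduced_walk_geodesic[OF this] show ?thesis
    using r s walk_append_ends(2)[of r "d x m" "\<lambda>i. s (d y m - i)" "d y m"] assms(1)
      d_sym[OF \<open>y \<in> V\<close> edge_verts(1)[OF p(1)]]
    by (simp add: walk_append_ends(1))
qed

lemma not_between:
  assumes V: "x \<in> V" "m \<in> V" "y \<in> V" and nb: "\<not> B x m y"
  shows "\<exists>p. {m, p} \<in> E \<and> d x m = d x p + 1 \<and> d y m = d y p + 1"
proof -
  have "x \<noteq> m" "y \<noteq> m" using nb by (auto simp: between_def)
  then obtain p q where "{m, p} \<in> E" "d x m = d x p + 1" "{m, q} \<in> E" "d y m = d y q + 1"
    using ex_step V by metis
  moreover from this have "p = q" using glue[of x y m p q] V nb by (auto simp: between_def)
  ultimately show ?thesis by blast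
qed

lemma step_unique:
  assumes "x \<in> V" "{m, p} \<in> E" "d x m = d x p + 1" "{m, q} \<in> E" "d x m = d x q + 1"
  shows "p = q"
proof (rule ccontr)
  assume "p \<noteq> q"
  have "d q m = d q q + 1"
    using d_eq_1[of q m] edge_verts[OF assms(4)] assms(4) by (simp add: insert_commute)
  with glue[of x q m p q] have "d x q = d x m + d m q"
    using assms \<open>p \<noteq> q\<close> edge_verts by blast
  thus False using assms(5) by simp
qed

lemma between_sym: "x \<in> V \<Longrightarrow> y \<in> V \<Longrightarrow> z \<in> V \<Longrightarrow> B x z y \<Longrightarrow> B y z x"
  unfolding between_def using d_sym[of x y] d_sym[of x z] d_sym[of z y] by simp

text \<open>
  Removing \<open>z\<close> separates \<open>x\<close> from \<open>y\<close>, and \<open>w\<close> cannot lie on both sides.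
\<close>

lemma between_split:
  assumes V: "x \<in> V" "y \<in> V" "z \<in> V" "w \<in> V" and b: "B x z y"
  shows "B x z w \<or> B w z y"
proof (rule ccontr)
  assume "\<not> ?thesis"
  then obtain p q where p: "{z, p} \<in> E" "d x z = d x p + 1" "d w z = d w p + 1"
    and q: "{z, q} \<in> E" "d w z = d w q + 1" "d y z = d y q + 1"
    using not_between[of x z w] not_between[of w z y] V by metis
  have "p = q" using step_unique[of w z p q] V p q by blast
  hence "d x y \<le> d x p + d p y" "d p y = d y p" "d z y = d y z" "d y z = d y p + 1"
    using d_triangle[of x p y] d_sym V q edge_verts[OF p(1)] by auto
  thus False using b p(2) by (simp add: between_def)
qed

lemma between_unique:
  assumes V: "x \<in> V" "y \<in> V" "z \<in> V" "w \<in> V" and b: "B x z y" "B x w y" "d x z = d x w"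
  shows "z = w"
  using between_split[OF V b(1)] b V by (auto simp: between_def)

text \<open>
  In a tree, geodesics overlapping in a nontrivial segment fit together to a longer geodesic.
\<close>

lemma between_trans:
  assumes V: "x \<in> V" "y \<in> V" "z \<in> V" "w \<in> V" and b: "B x y z" "B y z w" "y \<noteq> z"
  shows "B x y w" "B x z w"
proof -
  have "\<not> B w y z"
  proof
    assume "B w y z"
    hence "d w z = d w y + d y z" "d y w = d y z + d z w" using b by (auto simp: between_def)
    thus False using d_sym[of w z] d_sym[of y w] V b(3) by auto
  qed
  thus 1: "B x y w" using between_split[of x z y w] V b by blast
  show "B x z w" using 1 b by (auto simp: between_def)
qed

lemma between_cases:
  assumes "x \<in> V" "{p, q} \<in> E"
  shows "B x p q \<or> B x q p"
proof (rule ccontr)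
  assume n: "\<not> ?thesis"
  note V = edge_verts[OF assms(2)]
  obtain r where r: "{p, r} \<in> E" "d x p = d x r + 1" "d q p = d q r + 1"
    using not_between[of x p q] n V assms by metis
  have 1: "d p q = 1" "d q p = 1" using d_eq_1 assms V by (auto simp: insert_commute)
  hence "r = q" using r edge_verts[OF r(1)] V by auto
  thus False using n r 1 by (auto simp: between_def)
qed

text \<open>
  The median is reached by walking from \<open>m\<close> as long as \<open>x\<close> and \<open>y\<close> lie in the same direction.
\<close>

lemma ex_median:
  assumes "x \<in> V" "m \<in> V" "y \<in> V"
  shows "\<exists>c\<in>V. B m c x \<and> B m c y \<and> B x c y"
  using assms(2)
proof (induction "d x m" arbitrary: m rule: less_induct)
  case less
  show ?case
  proof (cases "B x m y")
    case True
    thus ?thesis using less by (intro bexI[of _ m]) (auto simp: between_def)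
  next
    case False
    then obtain p where p: "{m, p} \<in> E" "d x m = d x p + 1" "d y m = d y p + 1"
      using not_between less assms by metis
    note V = edge_verts[OF p(1)]
    obtain c where c: "c \<in> V" "B p c x" "B p c y" "B x c y" using less(1)[of p] p V by auto
    have 1: "d m p = 1" using d_eq_1 p V by simp
    have "B m c z" if z: "z \<in> V" "d z m = d z p + 1" "B p c z" for z
    proof -
      have "d m c \<le> d m p + d p c" "d m z \<le> d m c + d c z" "d z m = d m z" "d z p = d p z"
        using d_triangle[of m p c] d_triangle[of m c z] d_sym[of z m] d_sym[of z p] V c z by auto
      thus ?thesis using z 1 by (auto simp: between_def)
    qed
    thus ?thesis using c p assms by blast
  qed
qed

lemma between_walk:
  assumes "\<And>i. i \<le> n \<Longrightarrow> x i \<in> V" "z \<in> V" "B (x 0) z (x n)" "0 < n"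
  shows "\<exists>i<n. B (x i) z (x (Suc i))"
  using assms
proof (induction n)
  case (Suc n)
  show ?case
  proof (cases "n = 0")
    case True
    thus ?thesis using Suc.prems by auto
  next
    case False
    have "B (x 0) z (x n) \<or> B (x n) z (x (Suc n))"
      by (rule between_split) (use Suc.prems in auto)
    thus ?thesis using Suc.IH Suc.prems False by (auto simp: less_Suc_eq)
  qed
qed simp

text \<open>
  Moving \<open>x\<close> by less than its distance to \<open>z\<close> does not leave the component of \<open>x\<close> in the complement
  of \<open>z\<close>.
\<close>

lemma between_perturb:
  assumes V: "x \<in> V" "y \<in> V" "z \<in> V" "x' \<in> V" "y' \<in> V"
    and b: "B x z y" "d x x' < d x z" "d y y' < d y z"
  shows "B x' z y'"
proof -
  have "\<not> B x z x'" using b by (auto simp: between_def)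
  hence "B x' z y" using between_split[OF V(1-4) b(1)] by blast
  moreover have "\<not> B y' z y"
  proof
    assume "B y' z y"
    from between_sym[OF _ _ _ this] have "B y z y'" using V by blast
    thus False using b by (auto simp: between_def)
  qed
  ultimately show ?thesis using between_split[of x' y z y'] V by blast
qed

lemma convex_subtree:
  assumes W: "W \<subseteq> V" "W \<noteq> {}"
    and conv: "\<And>x y z. x \<in> W \<Longrightarrow> y \<in> W \<Longrightarrow> z \<in> V \<Longrightarrow> B x z y \<Longrightarrow> z \<in> W"
  shows "simplicial_tree W {e \<in> E. e \<subseteq> W}"
  unfolding simplicial_tree_def
proof (intro conjI ballI)
  show "{e \<in> E. e \<subseteq> W} \<subseteq> {{u, v} |u v. u \<in> W \<and> v \<in> W \<and> u \<noteq> v}"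
  proof
    fix e assume e: "e \<in> {e \<in> E. e \<subseteq> W}"
    hence "e \<in> {{u, v} |u v. u \<in> V \<and> v \<in> V \<and> u \<noteq> v}"
      using tree by (auto simp: simplicial_tree_def)
    with e show "e \<in> {{u, v} |u v. u \<in> W \<and> v \<in> W \<and> u \<noteq> v}" by auto
  qed
  show "\<not> (\<exists>c. 3 \<le> length c \<and> distinct c \<and> successively (\<lambda>x y. {x, y} \<in> {e \<in> E. e \<subseteq> W}) c \<and>
            {last c, hd c} \<in> {e \<in> E. e \<subseteq> W})"
  proof
    assume "\<exists>c. 3 \<le> length c \<and> distinct c \<and> successively (\<lambda>x y. {x, y} \<in> {e \<in> E. e \<subseteq> W}) c \<and>
            {last c, hd c} \<in> {e \<in> E. e \<subseteq> W}"
    then obtain c where c: "3 \<le> length c" "distinct c"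
      "successively (\<lambda>x y. {x, y} \<in> {e \<in> E. e \<subseteq> W}) c" "{last c, hd c} \<in> E" by auto
    have "successively (\<lambda>x y. {x, y} \<in> E) c" by (rule successively_mono[OF c(3)]) simp
    thus False using tree c unfolding simplicial_tree_def by blast
  qed
  fix x y assume x: "x \<in> W" and "y \<in> W"
  thus "(x, y) \<in> {(x, y). {x, y} \<in> {e \<in> E. e \<subseteq> W}}\<^sup>*"
  proof (induction "d x y" arbitrary: y rule: less_induct)
    case less
    show ?case
    proof (cases "x = y")
      case False
      then obtain p where p: "{y, p} \<in> E" "d x y = d x p + 1"
        using ex_step[of x y] less.prems W by blast
      have "d p y = 1" using d_eq_1 edge_verts[OF p(1)] p by (simp add: insert_commute)
      hence "p \<in> W"
        using p edge_verts[OF p(1)] by (intro conv[OF less.prems(1,2)]) (simp_all add: between_def)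
      hence "(x, p) \<in> {(x, y). {x, y} \<in> {e \<in> E. e \<subseteq> W}}\<^sup>*" using less p by auto
      moreover have "(p, y) \<in> {(x, y). {x, y} \<in> {e \<in> E. e \<subseteq> W}}"
        using p \<open>p \<in> W\<close> less.prems by (simp add: insert_commute)
      ultimately show ?thesis by (rule rtrancl_into_rtrancl)
    qed simp
  qed
qed (use W in auto)

end

section \<open>Stabilizers in a tree with a group action\<close>

locale gtree_action =
  fixes G :: "('g, 'm) monoid_scheme" (structure) and T :: "('g, 'v) gtree"
  assumes gtree: "is_gtree G T"
begin

sublocale tree "verts T" "edges T"
  by unfold_locales (use gtree in \<open>simp add: is_gtree_def\<close>)

sublocale ga: group_action G "verts T" "act T"
  using gtree by (simp add: is_gtree_def)

sublocale group G
  using ga.group_hom by (simp add: group_hom_def)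

abbreviation S where "S x \<equiv> vertex_stab G T x"

lemma in_stab: "h \<in> S x \<longleftrightarrow> h \<in> carrier G \<and> act T h x = x"
  by (simp add: stabilizer_def)

lemma stab_subgroup: "x \<in> verts T \<Longrightarrow> subgroup (S x) G"
  by (rule ga.stabilizer_subgroup)

lemma act_closed [simp]: "g \<in> carrier G \<Longrightarrow> x \<in> verts T \<Longrightarrow> act T g x \<in> verts T"
  by (rule ga.element_image) auto

lemma act_mult:
  "g \<in> carrier G \<Longrightarrow> h \<in> carrier G \<Longrightarrow> x \<in> verts T \<Longrightarrow> act T (g \<otimes> h) x = act T g (act T h x)"
  by (rule ga.composition_rule)

lemma act_one: "x \<in> verts T \<Longrightarrow> act T \<one> x = x"
  using fun_cong[OF ga.id_eq_one, of x] by simp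

lemma act_inv:
  assumes "g \<in> carrier G" "x \<in> verts T"
  shows "act T g (act T (inv g) x) = x" "act T (inv g) (act T g x) = x"
  using assms act_mult[of g "inv g" x] act_mult[of "inv g" g x] act_one by simp_all

lemma act_inj: "g \<in> carrier G \<Longrightarrow> x \<in> verts T \<Longrightarrow> y \<in> verts T \<Longrightarrow> act T g x = act T g y \<longleftrightarrow> x = y"
  by (rule iffI) (metis act_inv(2), simp)

lemma act_edge: "g \<in> carrier G \<Longrightarrow> {x, y} \<in> edges T \<Longrightarrow> {act T g x, act T g y} \<in> edges T"
proof -
  assume "g \<in> carrier G" "{x, y} \<in> edges T"
  hence "edge_act T g {x, y} \<in> edges T" using gtree unfolding is_gtree_def by blast
  thus ?thesis by simp
qed

lemma no_inversion:
  "g \<in> carrier G \<Longrightarrow> {x, y} \<in> edges T \<Longrightarrow> act T g x = y \<Longrightarrow> act T g y = x \<Longrightarrow> False"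
  using gtree by (auto simp: is_gtree_def)

lemma act_dist:
  assumes g: "g \<in> carrier G" and V: "x \<in> verts T" "y \<in> verts T"
  shows "d (act T g x) (act T g y) = d x y"
proof -
  have le: "d (act T h a) (act T h b) \<le> d a b"
    if h: "h \<in> carrier G" and ab: "a \<in> verts T" "b \<in> verts T" for h a b
  proof -
    obtain p where p: "walk (edges T) p (d a b)" "p 0 = a" "p (d a b) = b"
      using ex_geodesic[OF ab] by blast
    have "walk (edges T) (\<lambda>i. act T h (p i)) (d a b)"
      using p(1) act_edge[OF h] by (simp add: walk_def)
    from tdist_le[OF this] show ?thesis using p by simp
  qed
  show ?thesis
    using le[OF g V] le[of "inv g" "act T g x" "act T g y"] g V act_inv by simp
qed

lemma act_between:
  assumes "g \<in> carrier G" "x \<in> verts T" "y \<in> verts T" "z \<in> verts T" "B x z y"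
  shows "B (act T g x) (act T g z) (act T g y)"
  using assms by (simp add: between_def act_dist)

text \<open>
  An isometry fixing two vertices fixes the unique geodesic between them.
\<close>

lemma stab_between:
  assumes V: "x \<in> verts T" "y \<in> verts T" "z \<in> verts T" and b: "B x z y"
    and h: "h \<in> S x" "h \<in> S y"
  shows "h \<in> S z"
proof -
  have hc: "h \<in> carrier G" "act T h x = x" "act T h y = y" using h by (auto simp: in_stab)
  have "B x (act T h z) y" using act_between[OF hc(1) V b] hc by simp
  moreover have "d x z = d x (act T h z)" using act_dist[OF hc(1), of x z] V hc by simp
  ultimately have "z = act T h z" using between_unique[of x y z "act T h z"] V b hc by simp
  thus ?thesis using hc by (simp add: in_stab)
qed

text \<open>
  Without inversions the setwise stabilizer of an edge is its pointwise stabilizer.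
\<close>

lemma edge_stab_eq:
  assumes e: "{x, y} \<in> edges T"
  shows "edge_stab G T {x, y} = S x \<inter> S y"
proof -
  have "act T h x = x \<and> act T h y = y" if "h \<in> carrier G" "{act T h x, act T h y} = {x, y}" for h
    using that no_inversion[OF that(1) e] by (auto simp: doubleton_eq_iff)
  thus ?thesis by (auto simp: stabilizer_def)
qed

lemma stab_conj:
  assumes g: "g \<in> carrier G" and x: "x \<in> verts T"
  shows "h \<in> S (act T g x) \<longleftrightarrow> h \<in> carrier G \<and> inv g \<otimes> h \<otimes> g \<in> S x"
proof -
  have "act T h (act T g x) = act T g x \<longleftrightarrow> act T (inv g) (act T h (act T g x)) = x"
    if h: "h \<in> carrier G"
    using act_inv g x h by (metis act_closed)
  thus ?thesis using g x by (auto simp: in_stab act_mult)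
qed

lemma stab_mono_act:
  assumes "g \<in> carrier G" "x \<in> verts T" "y \<in> verts T" "S x \<subseteq> S y"
  shows "S (act T g x) \<subseteq> S (act T g y)"
  using assms by (auto simp: stab_conj)

lemma elliptic_stab: "x \<in> verts T \<Longrightarrow> elliptic G T (S x)"
  using stab_subgroup by (auto simp: elliptic_def in_stab)

lemma ellipticD: "elliptic G T H \<Longrightarrow> \<exists>x\<in>verts T. H \<subseteq> S x"
  unfolding elliptic_def in_stab subset_iff using subgroup.mem_carrier by fastforce

lemma ex_first_edge:
  assumes "v \<in> verts T" "w \<in> verts T" "v \<noteq> w"
  shows "\<exists>p. {v, p} \<in> edges T \<and> B v p w \<and> d w v = d w p + 1"
proof -
  obtain p where p: "{v, p} \<in> edges T" "d w v = d w p + 1" using ex_step[of w v] assms by auto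
  have "d v p = 1" "d w v = d v w" "d w p = d p w"
    using d_eq_1[of v p] d_sym[of w v] d_sym[of w p] assms edge_verts[OF p(1)] p(1) by auto
  thus ?thesis using p by (auto simp: between_def)
qed

lemma slide_freeD:
  assumes s: "strongly_slide_free G T" and e: "{v, x} \<in> edges T" "{v, y} \<in> edges T"
    and sub: "S v \<inter> S x \<subseteq> S y"
  shows "\<exists>k\<in>S v. act T k x = y"
proof -
  have "edge_stab G T {v, x} \<subseteq> edge_stab G T {v, y}"
    using sub edge_stab_eq e by auto
  then obtain k where k: "k \<in> S v" "edge_act T k {v, x} = {v, y}"
    using s e unfolding strongly_slide_free_def by (metis insertI1)
  have "act T k v = v" using k by (simp add: in_stab)
  moreover have "v \<noteq> y" using edge_verts(3)[OF e(2)] .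
  ultimately show ?thesis using k by (intro bexI[of _ k]) (auto simp: doubleton_eq_iff)
qed

lemma reducedD:
  assumes r: "reduced G T" and e: "{v, w} \<in> edges T" and sub: "S v \<subseteq> S w"
  shows "\<exists>g\<in>carrier G. w = act T g v"
proof -
  have "edge_stab G T {v, w} = S v" using sub edge_stab_eq[OF e] by auto
  hence "w \<in> orbit G (act T) v" using r e by (auto simp: reduced_def)
  thus ?thesis by (auto simp: orbit_def)
qed

lemma minimal_convex:
  assumes m: "minimal_gtree G T" and W: "W \<subseteq> verts T" "W \<noteq> {}"
    and conv: "\<And>x y z. x \<in> W \<Longrightarrow> y \<in> W \<Longrightarrow> z \<in> verts T \<Longrightarrow> B x z y \<Longrightarrow> z \<in> W"
    and inv: "\<And>g x. g \<in> carrier G \<Longrightarrow> x \<in> W \<Longrightarrow> act T g x \<in> W"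
  shows "W = verts T"
proof -
  have "simplicial_tree W {e \<in> edges T. e \<subseteq> W}" by (rule convex_subtree[OF W conv])
  moreover have "edge_act T g e \<in> {e \<in> edges T. e \<subseteq> W}"
    if "g \<in> carrier G" "e \<in> {e \<in> edges T. e \<subseteq> W}" for g e
    using gtree that inv unfolding is_gtree_def by auto
  ultimately show ?thesis
    using m W(1) inv unfolding minimal_gtree_def
    by (metis (no_types, lifting) mem_Collect_eq subsetI)
qed

lemma leaf_between:
  assumes V: "x \<in> verts T" "y \<in> verts T" and leaf: "{v, p} \<in> edges T"
    and uniq: "\<And>q. {v, q} \<in> edges T \<Longrightarrow> q = p" and b: "B x v y"
  shows "v = x \<or> v = y"
proof (rule ccontr)
  assume n: "\<not> ?thesis"
  note v = edge_verts[OF leaf]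
  have 1: "d x v = d x p + 1" using ex_step[of x v] V v n uniq by auto
  have 2: "d y v = d y p + 1" using ex_step[of y v] V v n uniq by auto
  have "d x y \<le> d x p + d p y" using d_triangle V v by blast
  moreover have "d y v = d v y" "d y p = d p y" using d_sym V v by auto
  ultimately show False using 1 2 b by (auto simp: between_def)
qed

text \<open>
  Removing the orbit of a leaf leaves an invariant convex set. It is nonempty, for if the neighbour of
  the leaf were in the same orbit, the tree would be one inverted edge.
\<close>

lemma minimal_no_leaf:
  assumes m: "minimal_gtree G T" and leaf: "{v, p} \<in> edges T"
    and uniq: "\<And>q. {v, q} \<in> edges T \<Longrightarrow> q = p"
  shows False
proof -
  note v = edge_verts[OF leaf]
  define W where "W = {x \<in> verts T. \<forall>g\<in>carrier G. x \<noteq> act T g v}"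
  have leaf': "{act T g v, act T g p} \<in> edges T" and uniq': "{act T g v, q} \<in> edges T \<Longrightarrow> q = act T g p"
    if g: "g \<in> carrier G" for g q
  proof -
    show "{act T g v, act T g p} \<in> edges T" using act_edge g leaf by blast
    assume e: "{act T g v, q} \<in> edges T"
    have "{v, act T (inv g) q} \<in> edges T" using act_edge[of "inv g", OF _ e] g v act_inv by simp
    hence "act T (inv g) q = p" by (rule uniq)
    thus "q = act T g p" using act_inv(1)[OF g edge_verts(2)[OF e]] by simp
  qed
  have "p \<in> W"
    unfolding W_def
  proof (clarsimp simp: v)
    fix g assume g: "g \<in> carrier G" "p = act T g v"
    have "v = act T g p" using uniq'[OF g(1), of v] leaf g by (simp add: insert_commute)
    thus False using no_inversion[OF g(1) leaf] g by simp
  qed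
  have "W = verts T"
  proof (rule minimal_convex[OF m])
    fix x y z assume xyz: "x \<in> W" "y \<in> W" "z \<in> verts T" "B x z y"
    show "z \<in> W"
      unfolding W_def
    proof (clarsimp simp: xyz)
      fix g assume g: "g \<in> carrier G" "z = act T g v"
      have "z = x \<or> z = y"
        using leaf_between[OF _ _ leaf'[OF g(1)] uniq'[OF g(1)], of x y] g(2) xyz(1,2,4)
        unfolding W_def by blast
      thus False using xyz g by (auto simp: W_def)
    qed
  next
    fix g x assume g: "g \<in> carrier G" and x: "x \<in> W"
    have "act T g x \<noteq> act T h v" if h: "h \<in> carrier G" for h
    proof
      assume "act T g x = act T h v"
      hence "x = act T (inv g \<otimes> h) v"
        using g h x v act_inv(2)[OF g, of x] by (auto simp: act_mult W_def)
      thus False using x g h by (auto simp: W_def)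
    qed
    thus "act T g x \<in> W" using x g by (auto simp: W_def)
  qed (use \<open>p \<in> W\<close> in \<open>auto simp: W_def\<close>)
  moreover have "v \<notin> W"
    by (auto simp: W_def act_one v intro!: bexI[of _ "\<one>"])
  ultimately show False using v by blast
qed

text \<open>
  If \<open>G\<^sub>v\<close> fixes the neighbour \<open>p\<close> of \<open>v\<close>, then any edge at \<open>v\<close> has its stabilizer contained in that
  of \<open>{v, p}\<close>, hence is carried to \<open>{v, p}\<close> by an element of \<open>G\<^sub>v\<close>. Such an element fixes \<open>p\<close>, so
  \<open>{v, p}\<close> is the only edge at \<open>v\<close>.
\<close>

lemma slide_free_stab_maximal:
  assumes m: "minimal_gtree G T" and s: "strongly_slide_free G T"
    and V: "v \<in> verts T" "w \<in> verts T" and sub: "S v \<subseteq> S w"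
  shows "v = w"
proof (rule ccontr)
  assume "v \<noteq> w"
  then obtain p where p: "{v, p} \<in> edges T" "B v p w" using ex_first_edge[OF V] by blast
  have vp: "S v \<subseteq> S p" using stab_between[OF V _ p(2)] edge_verts[OF p(1)] sub by blast
  have "q = p" if q: "{v, q} \<in> edges T" for q
  proof -
    obtain k where "k \<in> S v" "act T k q = p"
      using slide_freeD[OF s q p(1)] vp by blast
    thus ?thesis using vp act_inj[of k q p] edge_verts[OF q] edge_verts[OF p(1)] by (auto simp: in_stab)
  qed
  thus False using minimal_no_leaf[OF m p(1)] by blast
qed

subsection \<open>Translations\<close>

lemma act_pow_add:
  assumes "g \<in> carrier G" "x \<in> verts T"
  shows "act T (g [^] (m + n :: nat)) x = act T (g [^] m) (act T (g [^] n) x)"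
  using assms by (simp add: nat_pow_mult[symmetric] act_mult)

lemma act_pow_Suc:
  assumes "g \<in> carrier G" "x \<in> verts T"
  shows "act T (g [^] Suc n) x = act T (g [^] n) (act T g x)"
  using assms by (simp add: act_mult)

lemma translation_dist:
  assumes g: "g \<in> carrier G" and x: "x \<in> verts T" and ne: "x \<noteq> act T g x"
    and b: "B x (act T g x) (act T g (act T g x))"
  shows "d (act T (g [^] (i::nat)) x) (act T (g [^] (i + n)) x) = n * d x (act T g x)"
proof -
  let ?x = "\<lambda>n::nat. act T (g [^] n) x"
  have X: "?x n \<in> verts T" for n using g x by simp
  have step: "d (?x n) (?x (Suc n)) = d x (act T g x)" for n
    unfolding act_pow_Suc[OF g x] using act_dist g x by simp
  have "B x (?x n) (?x (Suc n))" for n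
  proof (induction n)
    case 0
    show ?case using x by (simp add: act_one between_def)
  next
    case (Suc n)
    have "B (?x n) (?x (Suc n)) (?x (Suc (Suc n)))"
      using act_between[of "g [^] n", OF _ _ _ _ b] g x by (simp add: act_mult)
    moreover have "?x n \<noteq> ?x (Suc n)"
      unfolding act_pow_Suc[OF g x] using act_inj[of "g [^] n" x "act T g x"] g x ne by simp
    ultimately show ?case
      using between_trans(2)[of x "?x n" "?x (Suc n)" "?x (Suc (Suc n))"] X x Suc by blast
  qed
  hence "d x (?x n) = n * d x (act T g x)" for n
    by (induction n) (use x step in \<open>auto simp: act_one between_def\<close>)
  thus ?thesis unfolding act_pow_add[OF g x] using act_dist[of "g [^] i" x "?x n"] g x by simp
qed

lemma translation_between:
  assumes g: "g \<in> carrier G" and x: "x \<in> verts T" and ne: "x \<noteq> act T g x"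
    and b: "B x (act T g x) (act T g (act T g x))" and "i \<le> j" "j \<le> (k::nat)"
  shows "B (act T (g [^] i) x) (act T (g [^] j) x) (act T (g [^] k) x)"
proof -
  have "k - i = (j - i) + (k - j)" using assms(5,6) by simp
  hence "(k - i) * d x (act T g x) = (j - i) * d x (act T g x) + (k - j) * d x (act T g x)"
    by (simp only: distrib_right)
  thus ?thesis
  using translation_dist[OF g x ne b, of i "j - i"] translation_dist[OF g x ne b, of j "k - j"]
    translation_dist[OF g x ne b, of i "k - i"] assms(5,6)
  by (simp add: between_def)
qed

text \<open>
  If the path from \<open>a\<close> through \<open>g a\<close> to \<open>g\<^sup>2 a\<close> backtracks at \<open>g a\<close>, the neighbour of \<open>a\<close> in the
  direction of \<open>g a\<close> is displaced by less; when \<open>a\<close> is displaced by one, backtracking means an inversion.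
\<close>

lemma minimal_displacement:
  assumes g: "g \<in> carrier G" and a: "a \<in> verts T" and ne: "a \<noteq> act T g a"
    and min: "\<And>x. x \<in> verts T \<Longrightarrow> d a (act T g a) \<le> d x (act T g x)"
  shows "B a (act T g a) (act T g (act T g a))"
proof (rule ccontr)
  let ?t = "d a (act T g a)"
  assume "\<not> ?thesis"
  then obtain p where p: "{act T g a, p} \<in> edges T" "?t = d a p + 1"
    "d (act T g (act T g a)) (act T g a) = d (act T g (act T g a)) p + 1"
    using not_between[of a "act T g a" "act T g (act T g a)"] a g by auto
  note P = edge_verts[OF p(1)]
  define b where "b = act T (inv g) p"
  have b: "b \<in> verts T" "act T g b = p" using P g act_inv(1) by (auto simp: b_def)
  have ab: "{a, b} \<in> edges T" using act_edge[of "inv g", OF _ p(1)] g a act_inv by (simp add: b_def)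
  have ab1: "d a b = 1" using d_eq_1 ab a b by simp
  have "d (act T g (act T g a)) (act T g b) = d (act T g a) b" by (rule act_dist) (use a b g in auto)
  moreover have "d (act T g (act T g a)) (act T g a) = d (act T g a) a"
    by (rule act_dist) (use a g in auto)
  ultimately have bt: "d (act T g a) a = d (act T g a) b + 1" using p(3) b by simp
  have sym: "d (act T g a) a = ?t" "d (act T g a) b = d b (act T g a)" using d_sym a b g by auto
  have Bb: "B a b (act T g a)" using bt sym ab1 by (simp add: between_def)
  have p1: "d p (act T g a) = 1" using d_eq_1 P p(1) by (simp add: insert_commute)
  show False
  proof (cases "?t = 1")
    case True
    hence "a = p" "act T g a = b" using p(2) bt sym a b P g by auto
    thus False using no_inversion[OF g ab] b by simp
  next
    case False
    have "d b p + 2 \<le> ?t"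
      using between_split[OF a _ b(1) P(2) Bb]
    proof
      assume "B a b p"
      thus ?thesis using p(2) ab1 by (simp add: between_def)
    next
      assume "B p b (act T g a)"
      hence "d p b + d b (act T g a) = 1" using p1 by (simp add: between_def)
      thus ?thesis using False bt sym p(2) d_sym[of p b] b P by simp
    qed (use g a in simp)
    thus False using min[OF b(1)] b(2) by simp
  qed
qed

end

section \<open>Comparing a strongly slide-free tree with a reduced one\<close>

locale rigidity =
  A: gtree_action G T + A': gtree_action G T'
  for G :: "('g, 'm) monoid_scheme" (structure)
    and T :: "('g, 'v) gtree" and T' :: "('g, 'w) gtree" +
  assumes min: "minimal_gtree G T" and ssf: "strongly_slide_free G T" and red: "reduced G T'"
    and same: "\<And>H. subgroup H G \<Longrightarrow> elliptic G T H \<longleftrightarrow> elliptic G T' H"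
begin

lemma maximal: "v \<in> verts T \<Longrightarrow> w \<in> verts T \<Longrightarrow> A.S v \<subseteq> A.S w \<Longrightarrow> v = w"
  by (rule A.slide_free_stab_maximal[OF min ssf])

text \<open>
  Equality of the elliptic subgroups enters only through this lemma and the next one.
\<close>

lemma ex_host: assumes "u \<in> verts T'" shows "\<exists>z\<in>verts T. A'.S u \<subseteq> A.S z"
  using A'.elliptic_stab[OF assms] same[OF A'.stab_subgroup[OF assms]] A.ellipticD by blast

lemma ex_host': assumes "v \<in> verts T" shows "\<exists>u\<in>verts T'. A.S v \<subseteq> A'.S u"
  using A.elliptic_stab[OF assms] same[OF A.stab_subgroup[OF assms]] A'.ellipticD by blast

text \<open>
  The vertex chosen here is unique, by \<open>f_unique\<close> below.
\<close>

definition f :: "'v \<Rightarrow> 'w" where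
  "f v = (SOME u. u \<in> verts T' \<and> A.S v \<subseteq> A'.S u)"

lemma f_some: "v \<in> verts T \<Longrightarrow> f v \<in> verts T' \<and> A.S v \<subseteq> A'.S (f v)"
  unfolding f_def by (rule someI_ex) (use ex_host' in blast)

lemma f_closed [simp]: "v \<in> verts T \<Longrightarrow> f v \<in> verts T'"
  using f_some by blast

lemma f_stab: assumes v: "v \<in> verts T" shows "A'.S (f v) = A.S v"
proof -
  obtain z where z: "z \<in> verts T" "A'.S (f v) \<subseteq> A.S z" using ex_host f_closed[OF v] by blast
  have "v = z" using maximal[OF v z(1)] f_some[OF v] z by blast
  thus ?thesis using f_some[OF v] z by blast
qed

lemma act_f_stab:
  assumes "g \<in> carrier G" "v \<in> verts T"
  shows "A'.S (act T' g (f v)) = A.S (act T g v)"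
  by (rule Set.set_eqI) (simp add: assms f_stab A.stab_conj A'.stab_conj)

text \<open>
  If \<open>G\<^sub>v\<close> fixed another vertex, it would fix a neighbour of \<open>f v\<close>, which by reducedness is
  \<open>g (f v)\<close> for some \<open>g\<close>. Comparing stabilizers in \<open>T\<close> shows that \<open>g\<close> fixes \<open>v\<close>, hence \<open>f v\<close>.
\<close>

lemma f_unique:
  assumes v: "v \<in> verts T" and u: "u \<in> verts T'" and sub: "A.S v \<subseteq> A'.S u"
  shows "u = f v"
proof (rule ccontr)
  assume "u \<noteq> f v"
  then obtain p where p: "{f v, p} \<in> edges T'" "A'.B (f v) p u"
    using A'.ex_first_edge[of "f v" u] u v by auto
  note P = A'.edge_verts[OF p(1)]
  have "A'.S (f v) \<subseteq> A'.S p"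
    using A'.stab_between[OF P(1) u P(2) p(2)] sub f_stab[OF v] by blast
  then obtain g where g: "g \<in> carrier G" "p = act T' g (f v)"
    using A'.reducedD[OF red p(1)] by blast
  have "A.S v \<subseteq> A.S (act T g v)"
    using act_f_stab[OF g(1) v] f_stab[OF v] g \<open>A'.S (f v) \<subseteq> A'.S p\<close> by simp
  hence "v = act T g v" by (rule maximal[OF v A.act_closed[OF g(1) v]])
  hence "g \<in> A'.S (f v)" using f_stab[OF v] g A.in_stab[of g v] by simp
  thus False using g P(3) by (simp add: A'.in_stab)
qed

lemma f_act: "g \<in> carrier G \<Longrightarrow> v \<in> verts T \<Longrightarrow> f (act T g v) = act T' g (f v)"
  by (rule f_unique[symmetric]) (simp_all add: act_f_stab)

lemma f_inj: "v \<in> verts T \<Longrightarrow> w \<in> verts T \<Longrightarrow> f v = f w \<longleftrightarrow> v = w"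
  using f_stab[of v] f_stab[of w] maximal[of v w] by auto

text \<open>
  Otherwise \<open>u = g (f v)\<close> for some \<open>g\<close> by reducedness, so \<open>G\<^sub>u\<close> is the stabilizer of \<open>g v\<close>, and
  \<open>g v = v\<close> by maximality. Hence a path in \<open>T'\<close> that leaves \<open>f v\<close> is sent back to a path in \<open>T\<close>
  that leaves \<open>v\<close> at once.
\<close>

lemma neighbour_host:
  assumes v: "v \<in> verts T" and e: "{f v, u} \<in> edges T'"
  shows "\<not> A'.S u \<subseteq> A.S v"
proof
  note U = A'.edge_verts[OF e]
  assume sub: "A'.S u \<subseteq> A.S v"
  have "{u, f v} \<in> edges T'" "A'.S u \<subseteq> A'.S (f v)"
    using e sub f_stab[OF v] by (simp_all add: insert_commute)
  then obtain g where g: "g \<in> carrier G" "f v = act T' g u"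
    using A'.reducedD[OF red] by blast
  have u: "act T' (inv g) (f v) = u" unfolding g(2) by (rule A'.act_inv(2)[OF g(1) U(2)])
  have "A.S (act T (inv g) v) \<subseteq> A.S v" using act_f_stab[of "inv g" v] g(1) v u sub by simp
  hence "act T (inv g) v = v" using maximal[OF A.act_closed[OF A.inv_closed[OF g(1)] v] v] by blast
  hence "u = f v" using f_act[of "inv g" v] u g(1) v by simp
  thus False using U by simp
qed

subsection \<open>Lower bound for distances\<close>

text \<open>
  \<open>{s, t}\<close> is an edge of the geodesic from \<open>f x\<close> to \<open>f v\<close>, met in this order, and is
  stabilized by nothing more than \<open>{x, v}\<close> is. The opposite inclusion holds for each
  edge of that geodesic.
\<close>

definition core :: "'v \<Rightarrow> 'v \<Rightarrow> 'w \<Rightarrow> 'w \<Rightarrow> bool" where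
  "core x v s t \<longleftrightarrow> {s, t} \<in> edges T' \<and>
     A'.d (f x) (f v) = A'.d (f x) s + 1 + A'.d t (f v) \<and> A'.S s \<inter> A'.S t \<subseteq> A.S x \<inter> A.S v"

lemma core_sym:
  assumes V: "x \<in> verts T" "v \<in> verts T" and c: "core x v s t"
  shows "core v x t s"
proof -
  have st: "s \<in> verts T'" "t \<in> verts T'" using c A'.edge_verts[of s t] by (auto simp: core_def)
  show ?thesis
    using c A'.d_sym[of "f x" "f v"] A'.d_sym[of "f x" s] A'.d_sym[of t "f v"] st V
    unfolding core_def by (auto simp: insert_commute)
qed

text \<open>
  Each vertex on the geodesic from \<open>f x\<close> to \<open>f v\<close> is assigned a vertex of \<open>T\<close> with a larger
  stabilizer. By maximality the two ends go to \<open>x\<close> and \<open>v\<close>, so at some step the assigned vertices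
  pass from the side of \<open>x\<close> to the side of \<open>v\<close>.
\<close>

lemma ex_host_edge:
  assumes e: "{x, v} \<in> edges T"
  shows "\<exists>s t z z'. {s, t} \<in> edges T' \<and> A'.d (f x) (f v) = A'.d (f x) s + 1 + A'.d t (f v) \<and>
    z \<in> verts T \<and> z' \<in> verts T \<and> A'.S s \<subseteq> A.S z \<and> A'.S t \<subseteq> A.S z' \<and> A.B z x v \<and> A.B x v z'"
proof -
  note V = A.edge_verts[OF e]
  let ?n = "A'.d (f x) (f v)"
  obtain p where p: "walk (edges T') p ?n" "p 0 = f x" "p ?n = f v"
    using A'.ex_geodesic[of "f x" "f v"] V by auto
  have pV: "p i \<in> verts T'" if "i \<le> ?n" for i using A'.walk_verts[OF p(1) _ that] p V by simp
  have "\<forall>i. \<exists>z. i \<le> ?n \<longrightarrow> z \<in> verts T \<and> A'.S (p i) \<subseteq> A.S z" using ex_host pV by blast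
  then obtain h where h: "\<And>i. i \<le> ?n \<Longrightarrow> h i \<in> verts T" "\<And>i. i \<le> ?n \<Longrightarrow> A'.S (p i) \<subseteq> A.S (h i)"
    by metis
  have h0: "h 0 = x" using maximal[OF V(1) h(1)[of 0]] h(2)[of 0] p f_stab V by simp
  have hn: "h ?n = v" using maximal[OF V(2) h(1)[of ?n]] h(2)[of ?n] p f_stab V by simp
  have 1: "A.d x v = 1" "A.d v x = 1" using A.d_eq_1 e V by (auto simp: insert_commute)
  \<comment> \<open>the first step of the returned path that lies beyond the edge\<close>
  define i where "i = (LEAST i. A.B x v (h i))"
  have ex: "A.B x v (h ?n)" using V by (simp add: hn between_def)
  have i: "A.B x v (h i)" "i \<le> ?n"
    unfolding i_def by (rule LeastI[of "\<lambda>i. A.B x v (h i)", OF ex]) (rule Least_le[of "\<lambda>i. A.B x v (h i)", OF ex])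
  have "i \<noteq> 0" using i(1) h0 1 V by (cases i) (auto simp: between_def)
  then obtain j where j: "i = Suc j" by (cases i) auto
  have "\<not> A.B x v (h j)" using not_less_Least[of j "\<lambda>i. A.B x v (h i)"] j by (simp add: i_def)
  hence "A.B (h j) x v"
    using A.between_cases[OF _ e, of "h j"] A.between_sym[of "h j" x v] h(1)[of j] i j V by auto
  moreover have e': "{p j, p (Suc j)} \<in> edges T'" using p(1) i j by (simp add: walk_def)
  moreover have "?n = A'.d (f x) (p j) + 1 + A'.d (p (Suc j)) (f v)"
  proof (rule antisym)
    have "A'.d (p j) (p (Suc j)) = 1" using A'.d_eq_1 e' A'.edge_verts[OF e'] by simp
    thus "?n \<le> A'.d (f x) (p j) + 1 + A'.d (p (Suc j)) (f v)"
      using A'.d_triangle[of "f x" "p j" "f v"] A'.d_triangle[of "p j" "p (Suc j)" "f v"]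
        A'.edge_verts[OF e'] V by simp
    have "A'.d (f x) (p j) \<le> j" using tdist_le[OF walk_take[OF p(1), of j]] i j p by simp
    moreover have "walk (edges T') (\<lambda>l. p (i + l)) (?n - i)" using p(1) by (simp add: walk_def)
    from tdist_le[OF this] have "A'.d (p i) (f v) \<le> ?n - i" using i(2) p(3) by simp
    ultimately show "A'.d (f x) (p j) + 1 + A'.d (p (Suc j)) (f v) \<le> ?n" using i j by simp
  qed
  ultimately show ?thesis
    using i j h(1)[of j] h(1)[of i] h(2)[of j] h(2)[of i]
    by (intro exI[of _ "p j"] exI[of _ "p i"] exI[of _ "h j"] exI[of _ "h i"]) auto
qed

lemma ex_core:
  assumes e: "{x, v} \<in> edges T"
  shows "\<exists>s t. core x v s t"
proof -
  note V = A.edge_verts[OF e]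
  obtain s t z z' where st: "{s, t} \<in> edges T'" "A'.d (f x) (f v) = A'.d (f x) s + 1 + A'.d t (f v)"
    and z: "z \<in> verts T" "z' \<in> verts T" "A'.S s \<subseteq> A.S z" "A'.S t \<subseteq> A.S z'"
      "A.B z x v" "A.B x v z'"
    using ex_host_edge[OF e] by metis
  have "A.B z x z'" "A.B z v z'" using A.between_trans[of z x v z'] z V by auto
  hence "A.S z \<inter> A.S z' \<subseteq> A.S x \<inter> A.S v"
    using A.stab_between[OF z(1,2) V(1)] A.stab_between[OF z(1,2) V(2)] by blast
  thus ?thesis using st z unfolding core_def by blast
qed

text \<open>
  Let \<open>u\<close> be the first vertex after \<open>f v\<close> on the shared segment and \<open>z\<close> a vertex of \<open>T\<close> with
  \<open>G\<^sub>u \<subseteq> G\<^sub>z\<close>. The stabilizers of \<open>{v, x}\<close> and \<open>{v, y}\<close> fix \<open>u\<close>, hence the first edge from \<open>v\<close> to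
  \<open>z\<close>, and slide-freeness puts all three edges in one orbit under \<open>G\<^sub>v\<close>.
\<close>

lemma ex_fold:
  assumes e: "{v, x} \<in> edges T" "{v, y} \<in> edges T"
    and m: "m \<in> verts T'" "m \<noteq> f v" "A'.B (f v) m (f x)" "A'.B (f v) m (f y)"
  shows "\<exists>k\<in>A.S v. act T k x = y \<and> act T' k m = m"
proof -
  note V = A.edge_verts[OF e(1)] A.edge_verts[OF e(2)]
  obtain u where u: "{f v, u} \<in> edges T'" "A'.B (f v) u m"
    using A'.ex_first_edge[of "f v" m] m V by auto
  note U = A'.edge_verts[OF u(1)]
  obtain z where z: "z \<in> verts T" "A'.S u \<subseteq> A.S z" using ex_host U by blast
  have "v \<noteq> z" using neighbour_host[OF V(1) u(1)] z by blast
  then obtain w where w: "{v, w} \<in> edges T" "A.B v w z" using A.ex_first_edge[OF V(1) z(1)] by blast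
  have to_w: "\<exists>k\<in>A.S v. act T k a = w"
    if a: "{v, a} \<in> edges T" and b: "A'.B (f v) m (f a)" for a
  proof (rule A.slide_freeD[OF ssf a w(1)], rule subsetI)
    note W = A.edge_verts[OF a] A.edge_verts[OF w(1)]
    fix h assume h: "h \<in> A.S v \<inter> A.S a"
    have "A'.d (f v) (f a) \<le> A'.d (f v) u + A'.d u (f a)" "A'.d u (f a) \<le> A'.d u m + A'.d m (f a)"
      using A'.d_triangle W U m by auto
    hence "A'.B (f v) u (f a)" using b u(2) by (auto simp: between_def)
    from A'.stab_between[OF _ _ _ this] have "h \<in> A'.S u" using h W U f_stab by auto
    hence "h \<in> A.S z" using z by blast
    thus "h \<in> A.S w" using A.stab_between[OF _ _ _ w(2)] h W z by blast
  qed
  obtain k1 k2 where k: "k1 \<in> A.S v" "act T k1 x = w" "k2 \<in> A.S v" "act T k2 y = w"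
    using to_w[OF e(1) m(3)] to_w[OF e(2) m(4)] by blast
  have kc: "k1 \<in> carrier G" "k2 \<in> carrier G" using k by (auto simp: A.in_stab)
  define k' where "k' = inv k2 \<otimes> k1"
  have k'c: "k' \<in> carrier G" using kc by (simp add: k'_def)
  have k'v: "k' \<in> A.S v"
    using subgroup.m_closed[OF A.stab_subgroup] subgroup.m_inv_closed[OF A.stab_subgroup] k V
    by (simp add: k'_def)
  have k'x: "act T k' x = y"
    using kc k V A.act_inv(2)[of k2 y] by (simp add: k'_def A.act_mult)
  have fv: "act T' k' (f v) = f v" using f_act[OF k'c V(1)] k'v by (simp add: A.in_stab)
  have fx: "act T' k' (f x) = f y" using f_act[OF k'c V(2)] k'x by simp
  have "A'.B (f v) (act T' k' m) (f y)"
    using A'.act_between[OF k'c _ _ m(1,3)] V fv fx by simp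
  moreover have "A'.d (f v) m = A'.d (f v) (act T' k' m)"
    using A'.act_dist[OF k'c, of "f v" m] m V fv by simp
  ultimately have "m = act T' k' m"
    using A'.between_unique[of "f v" "f y" m "act T' k' m"] m V k'c by simp
  thus ?thesis using k'v k'x by auto
qed

text \<open>
  If the core edge were in the folded segment from \<open>f v\<close> to \<open>m\<close>, it would be fixed by the element
  \<open>k\<close> of the fold, which moves \<open>x\<close>.
\<close>

lemma core_survives:
  assumes e: "{v, x} \<in> edges T" "{v, y} \<in> edges T" and "x \<noteq> y"
    and m: "m \<in> verts T'" "A'.B (f v) m (f x)" "A'.B (f v) m (f y)"
    and c: "core x v s t"
  shows "A'.d (f x) m = A'.d (f x) s + 1 + A'.d t m"
proof (cases "m = f v")
  case True
  thus ?thesis using c by (simp add: core_def)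
next
  case False
  note V = A.edge_verts[OF e(1)] A.edge_verts[OF e(2)]
  obtain k where k: "k \<in> A.S v" "act T k x = y" "act T' k m = m"
    using ex_fold[OF e m(1) False m(2,3)] by blast
  have st: "{s, t} \<in> edges T'" using c by (simp add: core_def)
  note ST = A'.edge_verts[OF st]
  have 1: "A'.d s t = 1" "A'.d t s = 1" using A'.d_eq_1 st ST by (auto simp: insert_commute)
  have sum: "A'.d (f x) (f v) = A'.d (f x) s + 1 + A'.d t (f v)" using c by (simp add: core_def)
  have tri: "A'.d (f x) (f v) \<le> A'.d (f x) s + A'.d s (f v)" "A'.d s (f v) \<le> A'.d s t + A'.d t (f v)"
    "A'.d (f x) (f v) \<le> A'.d (f x) t + A'.d t (f v)" "A'.d (f x) t \<le> A'.d (f x) s + A'.d s t"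
    using A'.d_triangle ST V by auto
  have b1: "A'.B s t (f v)" using sum tri 1 by (simp add: between_def)
  have b2: "A'.B (f x) s t" using sum tri 1 by (simp add: between_def)
  show ?thesis
  proof (cases "A'.B m s t")
    case True
    have "A'.B m s (f v)" "A'.B m t (f v)"
      using A'.between_trans[of m s t "f v"] True b1 ST m V by auto
    moreover have "k \<in> A'.S m" "k \<in> A'.S (f v)"
      using k f_stab[OF V(1)] by (auto simp: A'.in_stab A.in_stab)
    ultimately have "k \<in> A'.S s \<inter> A'.S t"
      using A'.stab_between[of m "f v" s k] A'.stab_between[of m "f v" t k] ST m V by auto
    hence "k \<in> A.S x" using c by (auto simp: core_def)
    thus ?thesis using k \<open>x \<noteq> y\<close> by (simp add: A.in_stab)
  next
    case False
    hence "A'.B m t s" using A'.between_cases[OF m(1) st] by blast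
    from A'.between_sym[OF _ _ _ this] have "A'.B s t m" using ST m by blast
    hence "A'.B (f x) s m"
      using A'.between_trans[of "f x" s t m] b2 ST m V by auto
    thus ?thesis using \<open>A'.B s t m\<close> 1 by (simp add: between_def)
  qed
qed

text \<open>
  The case \<open>m\<close> = median of \<open>core_survives\<close> on both sides: the core edges of two consecutive edges
  are consecutive on a geodesic.
\<close>

lemma core_turn:
  assumes e: "{v, x} \<in> edges T" "{v, y} \<in> edges T" and "x \<noteq> y"
    and c: "core x v s t" "core v y s' t'"
  shows "A'.d s t' = 1 + A'.d t s' + 1"
proof -
  note V = A.edge_verts[OF e(1)] A.edge_verts[OF e(2)]
  have st: "{s, t} \<in> edges T'" "{s', t'} \<in> edges T'" using c by (auto simp: core_def)
  note ST = A'.edge_verts[OF st(1)] A'.edge_verts[OF st(2)]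
  have 1: "A'.d s t = 1" "A'.d s' t' = 1" using A'.d_eq_1 st ST by auto
  obtain m where m: "m \<in> verts T'" "A'.B (f v) m (f x)" "A'.B (f v) m (f y)" "A'.B (f x) m (f y)"
    using A'.ex_median[of "f x" "f v" "f y"] V by auto
  have "A'.d (f x) m = A'.d (f x) s + 1 + A'.d t m"
    by (rule core_survives[OF e \<open>x \<noteq> y\<close> m(1-3) c(1)])
  moreover have "A'.d (f y) m = A'.d (f y) t' + 1 + A'.d s' m"
    using core_survives[OF e(2,1) _ m(1,3,2) core_sym[OF _ _ c(2)]] \<open>x \<noteq> y\<close> V by auto
  moreover have "A'.d (f y) m = A'.d m (f y)" "A'.d (f y) t' = A'.d t' (f y)" "A'.d s' m = A'.d m s'"
    using A'.d_sym ST V m by auto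
  moreover have "A'.d (f x) (f y) = A'.d (f x) m + A'.d m (f y)" using m by (simp add: between_def)
  moreover have "A'.d (f x) (f y) \<le> A'.d (f x) s + A'.d s (f y)" "A'.d s (f y) \<le> A'.d s t' + A'.d t' (f y)"
    "A'.d s t' \<le> A'.d s t + A'.d t t'" "A'.d t t' \<le> A'.d t s' + A'.d s' t'"
    "A'.d t s' \<le> A'.d t m + A'.d m s'"
    using A'.d_triangle ST V m by auto
  ultimately show ?thesis using 1 by linarith
qed

text \<open>
  By \<open>core_turn\<close>, the core edges of a geodesic line up on one geodesic of \<open>T'\<close> that starts
  at \<open>f a\<close>, so at least one unit of length is gained at each step.
\<close>

lemma f_expands:
  assumes ab: "a \<in> verts T" "b \<in> verts T"
  shows "A.d a b \<le> A'.d (f a) (f b)"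
proof (cases "A.d a b")
  case (Suc N)
  let ?n = "A.d a b"
  obtain p where p: "walk (edges T) p ?n" "p 0 = a" "p ?n = b" using A.ex_geodesic[OF ab] by blast
  have pV: "p i \<in> verts T" if "i \<le> ?n" for i using A.walk_verts[OF p(1) _ that] p ab by simp
  have rw: "reduced_walk (edges T) p ?n" by (rule A.geodesic_reduced[OF p(1)]) (simp add: p)
  have ed: "{p i, p (Suc i)} \<in> edges T" if "i < ?n" for i using p(1) that by (simp add: walk_def)
  have "\<forall>i. \<exists>s t. i < ?n \<longrightarrow> core (p i) (p (Suc i)) s t" using ex_core ed by blast
  then obtain s t where st: "\<And>i. i < ?n \<Longrightarrow> core (p i) (p (Suc i)) (s i) (t i)" by metis
  have ste: "{s i, t i} \<in> edges T'" if "i < ?n" for i using st[OF that] by (simp add: core_def)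
  have st1: "A'.d (s i) (t i) = 1" if "i < ?n" for i
    using A'.d_eq_1 ste[OF that] A'.edge_verts[OF ste[OF that]] by simp
  have fa: "f a \<in> verts T'" using ab by simp
  have *: "A'.d (f a) (t i) = A'.d (f a) (s i) + 1 \<and> i + 1 \<le> A'.d (f a) (t i)" if "i < ?n" for i
    using that
  proof (induction i)
    case 0
    have "A'.d (f a) (f (p (Suc 0))) = A'.d (f a) (s 0) + 1 + A'.d (t 0) (f (p (Suc 0)))"
      using st[OF 0] p by (simp add: core_def)
    moreover have "A'.d (f a) (f (p (Suc 0))) \<le> A'.d (f a) (t 0) + A'.d (t 0) (f (p (Suc 0)))"
      "A'.d (f a) (t 0) \<le> A'.d (f a) (s 0) + A'.d (s 0) (t 0)"
      using A'.d_triangle fa A'.edge_verts[OF ste[OF 0]] pV[of "Suc 0"] 0 by auto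
    ultimately show ?case using st1[OF 0] by simp
  next
    case (Suc i)
    hence i: "i < ?n" by simp
    note ST = A'.edge_verts[OF ste[OF i]] A'.edge_verts[OF ste[OF Suc.prems]]
    have IH: "A'.d (f a) (t i) = A'.d (f a) (s i) + 1" "i + 1 \<le> A'.d (f a) (t i)"
      using Suc.IH i by auto
    have "p i \<noteq> p (Suc (Suc i))" using rw Suc.prems by (simp add: reduced_walk_def)
    hence turn: "A'.d (s i) (t (Suc i)) = 1 + A'.d (t i) (s (Suc i)) + 1"
      using core_turn[OF _ ed[OF Suc.prems] _ st[OF i] st[OF Suc.prems]] ed[OF i]
      by (simp add: insert_commute)
    have tri: "A'.d (s i) (t (Suc i)) \<le> A'.d (s i) (t i) + A'.d (t i) (t (Suc i))"
      "A'.d (t i) (t (Suc i)) \<le> A'.d (t i) (s (Suc i)) + A'.d (s (Suc i)) (t (Suc i))"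
      "A'.d (f a) (s (Suc i)) \<le> A'.d (f a) (t i) + A'.d (t i) (s (Suc i))"
      "A'.d (f a) (t (Suc i)) \<le> A'.d (f a) (s (Suc i)) + A'.d (s (Suc i)) (t (Suc i))"
      using A'.d_triangle ST fa by auto
    have "A'.B (s i) (t i) (t (Suc i))" "A'.B (f a) (s i) (t i)"
      using turn tri st1[OF i] st1[OF Suc.prems] IH by (auto simp: between_def)
    hence "A'.B (f a) (t i) (t (Suc i))"
      using A'.between_trans(2)[of "f a" "s i" "t i" "t (Suc i)"] ST fa by blast
    thus ?case using turn tri st1[OF i] st1[OF Suc.prems] IH by (auto simp: between_def)
  qed
  have N: "N < ?n" using Suc by simp
  note ST = A'.edge_verts[OF ste[OF N]]
  have fb: "f b \<in> verts T'" using ab by simp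
  have "p (Suc N) = b" using p(3) Suc by simp
  hence "A'.d (f (p N)) (f b) = A'.d (f (p N)) (s N) + 1 + A'.d (t N) (f b)"
    using st[OF N] by (simp add: core_def)
  moreover have "A'.d (f (p N)) (f b) \<le> A'.d (f (p N)) (s N) + A'.d (s N) (f b)"
    "A'.d (s N) (f b) \<le> A'.d (s N) (t N) + A'.d (t N) (f b)"
    using A'.d_triangle ST fb pV[of N] N by auto
  ultimately have "A'.B (s N) (t N) (f b)" using st1[OF N] by (simp add: between_def)
  moreover have "A'.B (f a) (s N) (t N)" using *[OF N] st1[OF N] by (simp add: between_def)
  ultimately have "A'.B (f a) (t N) (f b)"
    using A'.between_trans(2)[of "f a" "s N" "t N" "f b"] ST fa fb by blast
  thus ?thesis using *[OF N] Suc by (simp add: between_def)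
qed simp

subsection \<open>The isomorphism\<close>

text \<open>
  The argument is the one by two axes: \<open>u\<close>, \<open>g u\<close>, \<open>g\<^sup>2 u\<close>, and so on in \<open>T'\<close>, along which stabilizers
  grow, and \<open>a\<close>, \<open>g a\<close>, \<open>g\<^sup>2 a\<close>, and so on in \<open>T\<close>, where \<open>a\<close> is displaced least. An edge of the
  second axis whose image passes a vertex of the first has its stabilizer fixing that vertex, and
  then also, by \<open>G\<^sub>u \<subseteq> G\<^sub>y\<close>, the translates \<open>g\<^sup>n y\<close> with large \<open>n\<close>, between which the second
  axis runs. So this stabilizer fixes the next edge of the second axis.
\<close>

lemma f_surj:
  assumes u: "u \<in> verts T'"
  shows "\<exists>v\<in>verts T. f v = u"
proof (rule ccontr)
  assume not_image: "\<not> ?thesis"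
  obtain y where y: "y \<in> verts T" "A'.S u \<subseteq> A.S y" using ex_host u by blast
  have "u \<noteq> f y" using not_image y(1) by blast
  then obtain p where p: "{u, p} \<in> edges T'" "A'.B u p (f y)"
    using A'.ex_first_edge[OF u f_closed[OF y(1)]] by blast
  note P = A'.edge_verts[OF p(1)]
  have "A'.S u \<subseteq> A'.S p"
    using A'.stab_between[OF u f_closed[OF y(1)] P(2) p(2)] y(2) f_stab[OF y(1)] by blast
  then obtain g where g: "g \<in> carrier G" and pg: "p = act T' g u"
    using A'.reducedD[OF red p(1)] by blast
  have sub: "A'.S u \<subseteq> A'.S (act T' g u)" using \<open>A'.S u \<subseteq> A'.S p\<close> pg by simp
  have ne: "u \<noteq> act T' g u" and e: "{u, act T' g u} \<in> edges T'" using P p(1) pg by auto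
  let ?U = "\<lambda>n::nat. act T' (g [^] n) u"
  let ?Y = "\<lambda>n::nat. act T (g [^] n) y"
  have gn: "g [^] n \<in> carrier G" for n :: nat using g by simp
  have UV: "?U n \<in> verts T'" and YV: "?Y n \<in> verts T" for n using gn u y by auto

  have "A'.S (?U n) \<subseteq> A'.S (?U (Suc n))" for n
    unfolding A'.act_pow_Suc[OF g u] using A'.stab_mono_act[OF gn u _ sub] g u by simp
  hence subU: "A'.S (?U m) \<subseteq> A'.S (?U n)" if "m \<le> n" for m n
    using lift_Suc_mono_le[of "\<lambda>n. A'.S (?U n)", OF _ that] by blast
  have UY: "A'.S (?U n) \<subseteq> A.S (?Y n)" for n
    using A'.stab_mono_act[OF gn u f_closed[OF y(1)]] y f_stab act_f_stab[OF gn y(1)] by simp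

  have U2: "A'.B u (act T' g u) (act T' g (act T' g u))"
  proof (rule ccontr)
    assume "\<not> ?thesis"
    then obtain q where q: "{act T' g u, q} \<in> edges T'" "A'.d u (act T' g u) = A'.d u q + 1"
      "A'.d (act T' g (act T' g u)) (act T' g u) = A'.d (act T' g (act T' g u)) q + 1"
      using A'.not_between[of u "act T' g u" "act T' g (act T' g u)"] g u by auto
    note Q = A'.edge_verts[OF q(1)]
    have 1: "A'.d u (act T' g u) = 1" "A'.d (act T' g u) u = 1"
      using A'.d_eq_1 e g u by (auto simp: insert_commute)
    have "u = q" using q(2) 1 u Q by simp
    moreover have "A'.d (act T' g (act T' g u)) (act T' g u) = 1"
      using A'.act_dist[OF g, of "act T' g u" u] g u 1 by simp
    ultimately have "act T' g (act T' g u) = u" using q(3) u g by simp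
    thus False using A'.no_inversion[OF g e] by simp
  qed
  have d1: "A'.d u (act T' g u) = 1" using A'.d_eq_1 e g u by simp
  have dU: "A'.d (?U i) (?U (i + n)) = n" for i n
    using A'.translation_dist[OF g u ne U2] d1 by simp
  have U0: "?U 0 = u" using u by (simp add: A'.act_one)

  obtain a where a: "a \<in> verts T"
    and amin: "\<And>x. x \<in> verts T \<Longrightarrow> A.d a (act T g a) \<le> A.d x (act T g x)"
    using ex_has_least_nat[of "\<lambda>x. x \<in> verts T" y "\<lambda>x. A.d x (act T g x)"] y(1) by blast
  let ?A = "\<lambda>n::nat. act T (g [^] n) a"
  let ?t = "A.d a (act T g a)"
  let ?r = "A'.d u (f a)"
  have fa: "f a \<in> verts T'" using a by simp
  have AV: "?A n \<in> verts T" for n using gn a by simp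
  have A0: "?A 0 = a" using a by (simp add: A.act_one)
  have fA: "f (?A n) = act T' (g [^] n) (f a)" for n using f_act gn a by simp
  have UfA: "A'.d (?U n) (f (?A n)) = ?r" for n unfolding fA using A'.act_dist gn u fa by simp
  have UfA': "A'.d (f (?A n)) (?U n) = ?r" for n
    using UfA A'.d_sym[OF UV f_closed[OF AV]] by simp
  have d_fA: "A'.d (f a) (f (?A n)) \<le> 2 * ?r + n" for n
  proof -
    have "A'.d (f a) (f (?A n)) \<le> A'.d (f a) (?U 0) + A'.d (?U 0) (f (?A n))"
      "A'.d (?U 0) (f (?A n)) \<le> A'.d (?U 0) (?U n) + A'.d (?U n) (f (?A n))"
      by (rule A'.d_triangle[OF fa UV f_closed[OF AV]], rule A'.d_triangle[OF UV UV f_closed[OF AV]])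
    thus ?thesis using UfA'[of 0] UfA[of n] dU[of 0 n] A0 by simp
  qed

  \<comment> \<open>otherwise \<open>g\<close> would fix \<open>f a\<close>, but it moves \<open>u\<close> arbitrarily far away\<close>
  have a_ne: "a \<noteq> act T g a"
  proof
    assume "a = act T g a"
    hence ga: "act T g a = a" by simp
    have stay: "?A n = a" for n
    proof (induction n)
      case (Suc n)
      thus ?case using A.act_pow_Suc[OF g a, of n] ga by simp
    qed (rule A0)
    have "A'.d (?U (2 * ?r + 1)) (f a) = ?r" using UfA[of "2 * ?r + 1"] unfolding stay .
    moreover have "A'.d (?U 0) (?U (0 + (2 * ?r + 1))) = 2 * ?r + 1" by (rule dU)
    moreover have "A'.d (?U 0) (?U (2 * ?r + 1)) \<le> A'.d (?U 0) (f a) + A'.d (f a) (?U (2 * ?r + 1))"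
      using A'.d_triangle UV fa by blast
    moreover have "A'.d (f a) (?U (2 * ?r + 1)) = A'.d (?U (2 * ?r + 1)) (f a)"
      using A'.d_sym UV fa by blast
    ultimately show False using U0 by simp
  qed
  have A2: "A.B a (act T g a) (act T g (act T g a))"
    by (rule A.minimal_displacement[OF g a a_ne amin])
  \<comment> \<open>\<open>g\<^sup>n\<close> moves \<open>a\<close> by \<open>n ?t\<close> but \<open>f a\<close> by at most \<open>n + 2 ?r\<close>; any \<open>n > 2 ?r\<close> gives \<open>?t < 2\<close>\<close>
  have "(2 * ?r + 1) * ?t \<le> 2 * ?r + (2 * ?r + 1)"
    using A.translation_dist[OF g a a_ne A2, of 0 "2 * ?r + 1"] A0
      f_expands[OF a AV[of "2 * ?r + 1"]] d_fA[of "2 * ?r + 1"] by simp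
  also have "\<dots> < (2 * ?r + 1) * 2" by simp
  finally have "?t < 2" by (simp only: mult_less_cancel1)
  moreover have "?t \<noteq> 0" using a_ne a g by simp
  ultimately have t: "?t = 1" by simp
  have dA: "A.d (?A i) (?A (i + n)) = n" for i n
    using A.translation_dist[OF g a a_ne A2, of i n] t by simp
  have BA: "A.B (?A i) (?A j) (?A k)" if "i \<le> j" "j \<le> k" for i j k
    using A.translation_between[OF g a a_ne A2 that] .

  \<comment> \<open>the orbit of \<open>f a\<close> passes the vertex \<open>?U M\<close> of the axis of \<open>g\<close> in \<open>T'\<close>, between \<open>f (?A j)\<close> and
    its successor; \<open>M > ?r\<close> puts \<open>f a\<close> and its translate on different sides of \<open>?U M\<close>\<close>
  define M where "M = ?r + 1"
  have pass: "A'.B (f (?A 0)) (?U M) (f (?A (2 * M)))"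
  proof (rule A'.between_perturb[of "?U 0" "?U (2 * M)"])
    show "A'.B (?U 0) (?U M) (?U (2 * M))"
      using A'.translation_between[OF g u ne U2, of 0 M "2 * M"] by simp
    show "A'.d (?U 0) (f (?A 0)) < A'.d (?U 0) (?U M)" using UfA[of 0] dU[of 0 M] by (simp add: M_def)
    have "A'.d (?U (2 * M)) (?U M) = M"
      using dU[of M M] A'.d_sym[OF UV UV, of "2 * M" M] by (simp add: mult_2)
    thus "A'.d (?U (2 * M)) (f (?A (2 * M))) < A'.d (?U (2 * M)) (?U M)"
      using UfA[of "2 * M"] by (simp add: M_def)
  qed (rule UV f_closed[OF AV])+
  have "0 < 2 * M" by (simp add: M_def)
  then obtain j where j: "j < 2 * M" "A'.B (f (?A j)) (?U M) (f (?A (Suc j)))"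
    using A'.between_walk[of "2 * M" "\<lambda>i. f (?A i)" "?U M", OF f_closed[OF AV] UV pass] by blast

  \<comment> \<open>\<open>?U M\<close> has its stabilizer fixing all later \<open>?Y n\<close>, hence also a point \<open>?A (M + i)\<close> of the axis in \<open>T\<close>:
    here \<open>i > A.d a y\<close> suffices, and \<open>M + i \<ge> j + 2\<close> puts it beyond the edge of index \<open>j\<close>\<close>
  define i where "i = M + A.d a y + 2"
  have "A.B (?Y M) (?A (M + i)) (?Y (M + 2 * i))"
  proof (rule A.between_perturb[of "?A M" "?A (M + 2 * i)"])
    show "A.B (?A M) (?A (M + i)) (?A (M + 2 * i))" by (rule BA) auto
    have AY: "A.d (?A n) (?Y n) = A.d a y" for n using A.act_dist gn a y by simp
    have AA: "A.d (?A (M + 2 * i)) (?A (M + i)) = i"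
      using dA[of "M + i" i] A.d_sym[OF AV AV, of "M + 2 * i" "M + i"] by (simp add: mult_2 add.assoc)
    show "A.d (?A M) (?Y M) < A.d (?A M) (?A (M + i))"
      unfolding AY dA by (simp add: i_def)
    show "A.d (?A (M + 2 * i)) (?Y (M + 2 * i)) < A.d (?A (M + 2 * i)) (?A (M + i))"
      unfolding AY AA by (simp add: i_def)
  qed (use YV AV in auto)
  hence far: "A'.S (?U M) \<subseteq> A.S (?A (M + i))"
    using A.stab_between[OF YV YV AV] UY[of M] UY[of "M + 2 * i"] subU[of M "M + 2 * i"] by force

  have "A.S (?A (Suc j)) \<inter> A.S (?A j) \<subseteq> A.S (?A (Suc (Suc j)))"
  proof
    fix h assume h: "h \<in> A.S (?A (Suc j)) \<inter> A.S (?A j)"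
    hence "h \<in> A'.S (?U M)"
      using A'.stab_between[OF f_closed[OF AV] f_closed[OF AV] UV j(2), unfolded f_stab[OF AV]]
      by blast
    hence "h \<in> A.S (?A (M + i))" using far by blast
    moreover have "A.B (?A (Suc j)) (?A (Suc (Suc j))) (?A (M + i))"
      by (rule BA) (use j(1) in \<open>auto simp: i_def\<close>)
    ultimately show "h \<in> A.S (?A (Suc (Suc j)))" using A.stab_between[OF AV AV AV] h by blast
  qed
  moreover have edge: "{?A n, ?A (Suc n)} \<in> edges T" for n
    using A.d_eq_1[OF AV AV, of n "Suc n"] dA[of n 1] by simp
  moreover have "{?A (Suc j), ?A j} \<in> edges T" using edge[of j] by (simp add: insert_commute)
  ultimately obtain k where k: "k \<in> A.S (?A (Suc j))" "act T k (?A j) = ?A (Suc (Suc j))"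
    using A.slide_freeD[OF ssf] by blast
  have kc: "k \<in> carrier G" "act T k (?A (Suc j)) = ?A (Suc j)" using k by (auto simp: A.in_stab)
  have shift: "act T (inv g) (?A (Suc n)) = ?A n" for n
  proof -
    have "?A (Suc n) = act T g (?A n)" using A.act_pow_add[OF g a, of 1 n] g by simp
    thus ?thesis using A.act_inv(2)[OF g AV] by simp
  qed
  have "act T (inv g \<otimes> k) (?A j) = ?A (Suc j)" "act T (inv g \<otimes> k) (?A (Suc j)) = ?A j"
    by (simp_all only: A.act_mult[OF A.inv_closed[OF g] kc(1) AV] k(2) kc(2) shift)
  thus False by (rule A.no_inversion[OF A.m_closed[OF A.inv_closed[OF g] kc(1)] edge[of j]])
qed

text \<open>
  The distance bound shows that adjacent images have adjacent preimages. Conversely, now that each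
  vertex of \<open>T'\<close> is an image, the edge of \<open>ex_host_edge\<close> joins images \<open>f z\<close> and \<open>f z'\<close>, so \<open>z\<close> and
  \<open>z'\<close> are at distance at most one while \<open>x\<close> and \<open>v\<close> lie between them.
\<close>

lemma f_edge_iff:
  assumes V: "x \<in> verts T" "v \<in> verts T"
  shows "{f x, f v} \<in> edges T' \<longleftrightarrow> {x, v} \<in> edges T"
proof
  assume e: "{f x, f v} \<in> edges T'"
  have "x \<noteq> v" using A'.edge_verts(3)[OF e] by auto
  hence "A.d x v \<noteq> 0" using V by simp
  moreover have "A'.d (f x) (f v) = 1" using A'.d_eq_1 e V by simp
  ultimately have "A.d x v = 1" using f_expands[OF V] by simp
  thus "{x, v} \<in> edges T" using A.d_eq_1 V by simp
next
  assume e: "{x, v} \<in> edges T"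
  obtain s t z z' where st: "{s, t} \<in> edges T'"
    and z: "z \<in> verts T" "z' \<in> verts T" "A'.S s \<subseteq> A.S z" "A'.S t \<subseteq> A.S z'"
      "A.B z x v" "A.B x v z'"
    using ex_host_edge[OF e] by metis
  have host: "c = f b" if c: "c \<in> verts T'" and b: "b \<in> verts T" "A'.S c \<subseteq> A.S b" for b c
  proof -
    obtain b' where "b' \<in> verts T" "f b' = c" using f_surj c by blast
    thus ?thesis using maximal[of b' b] f_stab[of b'] b by blast
  qed
  have "s = f z" "t = f z'" using host A'.edge_verts[OF st] z by auto
  hence "A.d z z' \<le> 1" using f_expands[OF z(1,2)] A'.d_eq_1[of s t] A'.edge_verts[OF st] st by simp
  moreover have "A.B z x z'" using A.between_trans(1)[of z x v z'] z V A.edge_verts(3)[OF e] by blast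
  moreover have "A.d x v = 1" using A.d_eq_1 e V by simp
  ultimately have "A.d z x = 0" "A.d v z' = 0" using z(6) by (auto simp: between_def)
  hence "z = x" "z' = v" using V z by auto
  thus "{f x, f v} \<in> edges T'" using st \<open>s = f z\<close> \<open>t = f z'\<close> by simp
qed

lemma iso_f: "gtree_iso G T T' (restrict f (verts T))"
  unfolding gtree_iso_def
proof (intro conjI ballI)
  let ?F = "restrict f (verts T)"
  show "bij_betw ?F (verts T) (verts T')"
    using f_surj f_inj by (force simp: bij_betw_def inj_on_def)
  show "(\<lambda>e. ?F ` e) ` edges T = edges T'"
  proof (intro equalityI subsetI)
    fix e' assume "e' \<in> (\<lambda>e. ?F ` e) ` edges T"
    then obtain e where e: "e \<in> edges T" "e' = ?F ` e" by blast
    then obtain x v where xv: "e = {x, v}" "x \<in> verts T" "v \<in> verts T"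
      using A.tree unfolding simplicial_tree_def by blast
    thus "e' \<in> edges T'" using f_edge_iff[OF xv(2,3)] e by simp
  next
    fix e' assume e': "e' \<in> edges T'"
    then obtain s t where st: "e' = {s, t}" "s \<in> verts T'" "t \<in> verts T'"
      using A'.tree unfolding simplicial_tree_def by blast
    then obtain x v where xv: "x \<in> verts T" "v \<in> verts T" "s = f x" "t = f v" using f_surj by metis
    hence "{x, v} \<in> edges T" "e' = ?F ` {x, v}" using f_edge_iff e' st by auto
    thus "e' \<in> (\<lambda>e. ?F ` e) ` edges T" by blast
  qed
  fix g v assume "g \<in> carrier G" "v \<in> verts T"
  thus "?F (act T g v) = act T' g (?F v)" using f_act by simp
qed simp

lemma iso_unique:
  assumes F: "gtree_iso G T T' F"
  shows "F = restrict f (verts T)"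
proof (rule extensionalityI[of _ "verts T"])
  show "F \<in> extensional (verts T)" using F by (simp add: gtree_iso_def)
  fix v assume v: "v \<in> verts T"
  have "bij_betw F (verts T) (verts T')" using F by (simp add: gtree_iso_def)
  hence "F v \<in> verts T'" using v bij_betwE by blast
  moreover have "A.S v \<subseteq> A'.S (F v)"
  proof
    fix h assume "h \<in> A.S v"
    hence h: "h \<in> carrier G" "act T h v = v" by (auto simp: A.in_stab)
    have "F (act T h v) = act T' h (F v)" using F h(1) v by (simp add: gtree_iso_def)
    thus "h \<in> A'.S (F v)" using h by (simp add: A'.in_stab)
  qed
  ultimately show "F v = restrict f (verts T) v" using f_unique[OF v] v by simp
qed simp

end

section \<open>Elliptic subgroups along a deformation\<close>

lemma gtree_iso_elliptic:
  assumes iso: "gtree_iso G A B F"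
    and closed: "\<And>g v. g \<in> carrier G \<Longrightarrow> v \<in> verts A \<Longrightarrow> act A g v \<in> verts A"
  shows "elliptic G A H \<longleftrightarrow> elliptic G B H"
proof -
  have bij: "bij_betw F (verts A) (verts B)" using iso by (simp add: gtree_iso_def)
  have fixed: "act A h v = v \<longleftrightarrow> act B h (F v) = F v" if hv: "h \<in> carrier G" "v \<in> verts A" for h v
  proof -
    have "F (act A h v) = act B h (F v)" using iso hv by (simp add: gtree_iso_def)
    thus ?thesis using inj_on_eq_iff[OF bij_betw_imp_inj_on[OF bij] closed[OF hv] hv(2)] by simp
  qed
  have "(\<exists>v\<in>verts A. \<forall>h\<in>H. act A h v = v) \<longleftrightarrow> (\<exists>w\<in>verts B. \<forall>h\<in>H. act B h w = w)"
    if "subgroup H G"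
    unfolding bij_betw_imp_surj_on[OF bij, symmetric]
    using fixed subgroup.mem_carrier[OF that] by simp
  thus ?thesis unfolding elliptic_def by blast
qed

context gtree_action
begin

lemma slide_free_reduced:
  assumes "minimal_gtree G T" "strongly_slide_free G T"
  shows "reduced G T"
  unfolding reduced_def
proof (intro allI impI, elim conjE)
  fix v w assume e: "{v, w} \<in> edges T" and st: "edge_stab G T {v, w} = S v"
  have "S v \<subseteq> S w" using st edge_stab_eq[OF e] by auto
  thus "w \<in> orbit G (act T) v"
    using slide_free_stab_maximal[OF assms] edge_verts[OF e] by blast
qed

text \<open>
  Because \<open>G\<^sub>v\<close> fixes \<open>w\<close>, a well-defined equivariant retraction \<open>r\<close> moves \<open>g v\<close> to \<open>g w\<close> and fixes all
  other vertices. It is constant on each class of the collapse, so a subgroup preserving a class fixes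
  a vertex.
\<close>

lemma collapse_elliptic:
  assumes e: "{v, w} \<in> edges T" and st: "edge_stab G T {v, w} = S v" and w: "w \<notin> orbit G (act T) v"
  shows "elliptic G (collapse G T {v, w}) H \<longleftrightarrow> elliptic G T H"
    and "g \<in> carrier G \<Longrightarrow> C \<in> verts (collapse G T {v, w}) \<Longrightarrow>
      act (collapse G T {v, w}) g C \<in> verts (collapse G T {v, w})"
proof -
  note V = edge_verts[OF e]
  let ?T = "collapse G T {v, w}" and ?R = "collapse_rel G T {v, w}"
  let ?O = "{(a, b). {a, b} \<in> orbit G (edge_act T) {v, w}}"
  have O: "(a, b) \<in> ?O \<longleftrightarrow> (\<exists>g\<in>carrier G. {a, b} = {act T g v, act T g w})" for a b
    by (auto simp: orbit_def)
  have OV: "a \<in> verts T" "b \<in> verts T" if "(a, b) \<in> ?O" for a b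
    using that V unfolding O by (auto simp: doubleton_eq_iff)
  have O_act: "(act T h a, act T h b) \<in> ?O" if h: "h \<in> carrier G" and ab: "(a, b) \<in> ?O" for h a b
  proof -
    obtain g where g: "g \<in> carrier G" "{a, b} = {act T g v, act T g w}" using ab O by blast
    have "{act T h a, act T h b} = act T h ` {act T g v, act T g w}" using g(2) by (metis image_empty image_insert)
    also have "\<dots> = {act T (h \<otimes> g) v, act T (h \<otimes> g) w}" using h g V by (simp add: act_mult)
    finally show ?thesis using O h g by blast
  qed
  have R_act: "(act T h a, act T h b) \<in> ?R" if h: "h \<in> carrier G" and ab: "(a, b) \<in> ?R" for h a b
  proof -
    have "(act T h a, act T h b) \<in> ?O\<^sup>*" if "(a, b) \<in> ?O\<^sup>*"
      using that
    proof (induction rule: rtrancl_induct)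
      case (step b c)
      show ?case by (rule rtrancl_into_rtrancl[OF step.IH O_act[OF h step.hyps(2)]])
    qed simp
    thus ?thesis using ab h by (simp add: collapse_rel_def)
  qed
  have class_act: "act T h ` (?R `` {x}) = ?R `` {act T h x}"
    if h: "h \<in> carrier G" and x: "x \<in> verts T" for h x
  proof (intro equalityI subsetI)
    fix b assume "b \<in> ?R `` {act T h x}"
    hence b: "(act T h x, b) \<in> ?R" "b \<in> verts T" by (auto simp: collapse_rel_def)
    have "(x, act T (inv h) b) \<in> ?R" using R_act[of "inv h", OF _ b(1)] act_inv(2)[OF h x] h by simp
    thus "b \<in> act T h ` (?R `` {x})" using act_inv(1)[OF h b(2)] by force
  qed (use R_act[OF h] in auto)
  have verts: "verts ?T = (\<lambda>x. ?R `` {x}) ` verts T" by (auto simp: collapse_def quotient_def)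
  have act: "act ?T h (?R `` {x}) = ?R `` {act T h x}" if "h \<in> carrier G" "x \<in> verts T" for h x
    using class_act[OF that] that by (simp add: collapse_def quotientI)
  show "act ?T g C \<in> verts ?T" if "g \<in> carrier G" "C \<in> verts ?T" for g C
    using that act unfolding verts by auto

  define r where
    "r x = (if \<exists>g\<in>carrier G. x = act T g v then act T (SOME g. g \<in> carrier G \<and> x = act T g v) w else x)" for x
  have stab: "S v \<subseteq> S w" using st edge_stab_eq[OF e] by auto
  have r_v: "r (act T g v) = act T g w" if g: "g \<in> carrier G" for g
  proof -
    define k where "k = (SOME k. k \<in> carrier G \<and> act T g v = act T k v)"
    have k: "k \<in> carrier G" "act T g v = act T k v"
      unfolding k_def by (rule someI2[of _ g], use g in simp_all)+
    have "inv g \<otimes> k \<in> S v"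
      using g k V act_inv(2)[OF g V(1)] by (simp add: in_stab act_mult)
    hence "inv g \<otimes> k \<in> S w" using stab by blast
    hence "act T (inv g) (act T k w) = w" using g k V by (simp add: in_stab act_mult)
    hence "act T k w = act T g w" using act_inv(1)[OF g, of "act T k w"] k V by simp
    thus ?thesis using g unfolding r_def k_def by auto
  qed
  have r_other: "r x = x" if "\<And>g. g \<in> carrier G \<Longrightarrow> x \<noteq> act T g v" for x
    using that by (auto simp: r_def)
  have r_w: "r (act T g w) = act T g w" if g: "g \<in> carrier G" for g
  proof (rule r_other, rule notI)
    fix h assume h: "h \<in> carrier G" "act T g w = act T h v"
    have "w = act T (inv g \<otimes> h) v"
      using act_inv(2)[OF g V(2)] h g V by (simp add: act_mult)
    thus False using w g h by (auto simp: orbit_def)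
  qed
  have r_act: "r (act T h x) = act T h (r x)" if h: "h \<in> carrier G" and x: "x \<in> verts T" for h x
  proof (cases "\<exists>g\<in>carrier G. x = act T g v")
    case True
    then obtain g where g: "g \<in> carrier G" "x = act T g v" by blast
    thus ?thesis using r_v[of "h \<otimes> g"] r_v[of g] h V by (simp add: act_mult)
  next
    case False
    have "act T h x \<noteq> act T g v" if g: "g \<in> carrier G" for g
    proof
      assume "act T h x = act T g v"
      hence "x = act T (inv h \<otimes> g) v" using act_inv(2)[OF h x] h g V by (simp add: act_mult)
      thus False using False h g by blast
    qed
    thus ?thesis using r_other False by metis
  qed
  have r_closed: "r x \<in> verts T" if x: "x \<in> verts T" for x
  proof (cases "\<exists>g\<in>carrier G. x = act T g v")
    case True
    thus ?thesis using r_v V by auto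
  next
    case False
    thus ?thesis using r_other[of x] x by metis
  qed
  have r_O: "r a = r b" if ab: "(a, b) \<in> ?O" for a b
  proof -
    obtain g where "g \<in> carrier G" "{a, b} = {act T g v, act T g w}" using ab O by blast
    thus ?thesis using r_v r_w by (auto simp: doubleton_eq_iff)
  qed
  have r_R: "r a = r b" if "(a, b) \<in> ?R" for a b
  proof -
    have "(a, b) \<in> ?O\<^sup>*" using that by (simp add: collapse_rel_def)
    thus ?thesis by (induction rule: rtrancl_induct) (use r_O in auto)
  qed
  have refl: "(x, x) \<in> ?R" if "x \<in> verts T" for x using that by (simp add: collapse_rel_def)
  show "elliptic G ?T H \<longleftrightarrow> elliptic G T H"
  proof
    assume "elliptic G T H"
    then obtain x where x: "subgroup H G" "x \<in> verts T" "\<And>h. h \<in> H \<Longrightarrow> act T h x = x"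
      by (auto simp: elliptic_def)
    have "act ?T h (?R `` {x}) = ?R `` {x}" if "h \<in> H" for h
      using act[OF subgroup.mem_carrier[OF x(1) that] x(2)] x(3)[OF that] by simp
    thus "elliptic G ?T H" using x(1,2) unfolding elliptic_def verts by blast
  next
    assume "elliptic G ?T H"
    then obtain x where x: "subgroup H G" "x \<in> verts T"
      "\<And>h. h \<in> H \<Longrightarrow> act ?T h (?R `` {x}) = ?R `` {x}"
      unfolding elliptic_def verts by blast
    have "act T h (r x) = r x" if h: "h \<in> H" for h
    proof -
      have hc: "h \<in> carrier G" by (rule subgroup.mem_carrier[OF x(1) h])
      have "?R `` {act T h x} = ?R `` {x}" using act[OF hc x(2)] x(3)[OF h] by simp
      moreover have "act T h x \<in> ?R `` {act T h x}" using refl[OF act_closed[OF hc x(2)]] by simp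
      ultimately have "(x, act T h x) \<in> ?R" by simp
      thus ?thesis using r_R[of x "act T h x"] r_act[OF hc x(2)] by simp
    qed
    thus "elliptic G T H" using x(1) r_closed[OF x(2)] unfolding elliptic_def by blast
  qed
qed

end

lemma is_gtree_iso_elliptic:
  assumes "is_gtree G A" "gtree_iso G A B F"
  shows "elliptic G A H \<longleftrightarrow> elliptic G B H"
proof -
  interpret gtree_action G A by unfold_locales (rule assms)
  show ?thesis by (rule gtree_iso_elliptic[OF assms(2) act_closed])
qed

lemma collapse_move_elliptic:
  assumes "collapse_move G A B"
  shows "elliptic G A H \<longleftrightarrow> elliptic G B H"
proof -
  obtain v w F where e: "is_gtree G A" "{v, w} \<in> edges A" "edge_stab G A {v, w} = vertex_stab G A v"
    "w \<notin> orbit G (act A) v" "gtree_iso G (collapse G A {v, w}) B F"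
    using assms unfolding collapse_move_def by blast
  interpret gtree_action G A by unfold_locales (rule e)
  show ?thesis
    using gtree_iso_elliptic[OF e(5) collapse_elliptic(2)[OF e(2-4)]] collapse_elliptic(1)[OF e(2-4)]
    by blast
qed

lemma deformation_space_elliptic:
  assumes "T \<in> deformation_space G T0"
  shows "elliptic G T H \<longleftrightarrow> elliptic G T0 H"
proof -
  obtain S S' :: "('a, nat \<times> 'a set) gtree" and F F' where
    S: "is_gtree G T" "gtree_iso G T S F" "is_gtree G S'" "gtree_iso G S' T0 F'"
      "(\<lambda>A B. collapse_move G A B \<or> collapse_move G B A)\<^sup>*\<^sup>* S S'"
    using assms unfolding deformation_space_def deforms_to_def by blast
  from S(5) have "elliptic G S H \<longleftrightarrow> elliptic G S' H"
  proof (induction rule: rtranclp_induct)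
    case (step A B)
    from step.hyps(2) have "elliptic G A H \<longleftrightarrow> elliptic G B H"
      using collapse_move_elliptic[of G A B H] collapse_move_elliptic[of G B A H] by blast
    with step.IH show ?case by simp
  qed simp
  thus ?thesis
    using is_gtree_iso_elliptic[OF S(1,2)] is_gtree_iso_elliptic[OF S(3,4)] by simp
qed

lemma rigidity_iso:
  assumes "is_gtree G T" "is_gtree G T'" "minimal_gtree G T"
    and "\<And>H. subgroup H G \<Longrightarrow> elliptic G T H \<longleftrightarrow> elliptic G T' H"
    and "strongly_slide_free G T" "reduced G T'"
  shows "\<exists>!f. gtree_iso G T T' f"
proof -
  interpret rigidity G T T'
    using assms by (auto simp: rigidity_def gtree_action_def rigidity_axioms_def)
  show ?thesis using iso_f iso_unique by blast
qed

theorem mainTheorem1: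
  fixes G :: "('g, 'm) monoid_scheme"
  assumes "group G"
  shows
    "(\<forall>(T0 :: ('g, 'u) gtree) (T :: ('g, 'v) gtree) (T' :: ('g, 'w) gtree).
        is_gtree G T0 \<and> cocompact G T0 \<and>
        T \<in> deformation_space G T0 \<and> strongly_slide_free G T \<and> minimal_gtree G T \<and>
        T' \<in> deformation_space G T0 \<and> strongly_slide_free G T' \<and> minimal_gtree G T'
        \<longrightarrow> (\<exists>f. gtree_iso G T T' f)) \<and>
     (\<forall>(T :: ('g, 'v) gtree) (T' :: ('g, 'w) gtree).
        is_gtree G T \<and> is_gtree G T' \<and>
        minimal_gtree G T \<and> minimal_gtree G T' \<and>
        (\<forall>H. subgroup H G \<longrightarrow> (elliptic G T H \<longleftrightarrow> elliptic G T' H)) \<and>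
        strongly_slide_free G T \<and> reduced G T'
        \<longrightarrow> (\<exists>!f. gtree_iso G T T' f))"
proof (intro conjI allI impI; elim conjE)
  fix T0 :: "('g, 'u) gtree" and T :: "('g, 'v) gtree" and T' :: "('g, 'w) gtree"
  assume T: "T \<in> deformation_space G T0" "strongly_slide_free G T" "minimal_gtree G T"
    and T': "T' \<in> deformation_space G T0" "strongly_slide_free G T'" "minimal_gtree G T'"
  have gt: "is_gtree G T" "is_gtree G T'" using T(1) T'(1) by (auto simp: deformation_space_def)
  interpret T': gtree_action G T' by unfold_locales (rule gt)
  have "\<exists>!f. gtree_iso G T T' f"
    using rigidity_iso[OF gt T(3) _ T(2) T'.slide_free_reduced[OF T'(3,2)]]
      deformation_space_elliptic[OF T(1)] deformation_space_elliptic[OF T'(1)] by blast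
  thus "\<exists>f. gtree_iso G T T' f" by blast
next
  fix T :: "('g, 'v) gtree" and T' :: "('g, 'w) gtree"
  assume "is_gtree G T" "is_gtree G T'" "minimal_gtree G T"
    "\<forall>H. subgroup H G \<longrightarrow> elliptic G T H = elliptic G T' H"
    "strongly_slide_free G T" "reduced G T'"
  thus "\<exists>!f. gtree_iso G T T' f" by (intro rigidity_iso) simp_all
qed

end
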